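(* Let $S\subset\mathbb{R}^3$ be a compact connected orientable $\mathcal{C}^2$ surface (without boundary) with unit normal $N$ and principal curvatures $\kappa_1,\kappa_2$, and choose $r\in\mathbb{R}\setminus\{0\}$ such that $$\frac{1}{|r|}>\max_{p\in S,\ i=1,2}|\kappa_i(p)|.$$ Then $S$ is a (round) sphere if and only if $B_r$ rolls isotropically from every point of $S$.
   Context: Surfaces and curvature. $S$ is a connected orientable $\mathcal{C}^2$ surface in $\mathbb{R}^3$ with chosen unit normal field $N$. Principal curvatures $\kappa_1,\kappa_2$ are taken with respect to $N$, with the sign convention that the normal curvature of a unit-speed curve $\gamma$ in $S$ is $\langle\gamma'',N\rangle$. Curves are of class at least $\mathcal{C}^2$. The ball. For $p\in S$ and a real number $r\neq 0$ (possibly negative), $B_r$ is the ball of radius $|r|$ centered at $p+rN_p$. The object that actually rolls is its boundary sphere $\widetilde S=\partial B_r$, which is tangent to $S$ at $p$. Intersections between $B_r$ and $S$ are allowed. Rolling. Let $\gamma\colon[0,\ell]\to S$ be a unit-speed curve with $\gamma(0)=p$. A motion of $\widetilde S$ on $S$ along $\gamma$ is a smooth (it suffices: continuously differentiable in $t$) one-parameter family $f_t$, $t\in[0,\ell]$, of direct isometries $f_t(x)=A_tx+b_t$ of $\mathbb{R}^3$ with $f_0=\mathrm{id}$ such that $f_t(\widetilde S)$ is tangent to $S$ at $\gamma(t)$ for every $t$. Its instantaneous motion at $t$ is the vector field $X_t(x)=f_t'(f_t^{-1}(x))=Q_tx+v_t$, where the prime denotes the $t$-derivative, $Q_t=A_t'A_t^T$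 is skew-symmetric and $v_t=b_t'-Q_tb_t$. The angular velocity $\omega_t$ is the vector with $Q_tx=\omega_t\times x$ for all $x$. The motion is rotational if for every $t$ one has $Q_t\neq 0$ and $X_t(\gamma(t))=0$. A rolling (without skidding or spinning) of $B_r$ on $S$ along $\gamma$ is a rotational motion such that $\omega_t$ is tangent to $S$ at $\gamma(t)$ for every $t$. For the purposes here it suffices that a rolling exists along an arbitrarily short initial subarc $\gamma|_{[0,\varepsilon]}$, $\varepsilon>0$. Speed. The speed of $B_r$ at time $t$ while rolling along $\gamma$ is the length $\left|\frac{d}{dt}f_t(p+rN_p)\right|$ of the velocity of its center; the initial speed is the speed at $t=0$. Isotropic rolling. $B_r$ rolls isotropically from $p$ if its initial speed while rolling along a unit-speed curve $\gamma$ with $\gamma(0)=p$ does not depend on the direction $v=\gamma'(0)\in T_pS$; i.e. there is a constant $\sigma$ (which may depend on $p$) such that for every unit vector $v\in T_pS$ and every unit-speed curve $\gamma$ in $S$ with $\gamma(0)=p$, $\gamma'(0)=v$, the ball $B_r$ rolls on $S$ along an initial subarc of $\gamma$, with initial speed $\sigma$. *)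

theory Defs
  imports "HOL-Analysis.Analysis"
begin

section \<open>Surfaces and their curvature\<close>

text \<open>Intended for open \<open>U\<close>.\<close>

definition C2_on :: "('a::real_normed_vector) set \<Rightarrow> ('a \<Rightarrow> 'b::real_normed_vector) \<Rightarrow> bool" where
  "C2_on U f \<longleftrightarrow>
     (\<exists>(f' :: 'a \<Rightarrow> 'a \<Rightarrow>\<^sub>L 'b) (f'' :: 'a \<Rightarrow> 'a \<Rightarrow>\<^sub>L ('a \<Rightarrow>\<^sub>L 'b)).
        (\<forall>x\<in>U. (f has_derivative blinfun_apply (f' x)) (at x)) \<and>
        (\<forall>x\<in>U. (f' has_derivative blinfun_apply (f'' x)) (at x)) \<and>
        continuous_on U f'')"

text \<open>Surfaces are embedded and without boundary: every point has a relatively open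
  neighbourhood that is the homeomorphic image of a plane domain under a \<open>C\<^sup>2\<close> immersion.\<close>

definition C2_surface :: "(real^3) set \<Rightarrow> bool" where
  "C2_surface S \<longleftrightarrow>
     (\<forall>p\<in>S. \<exists>(U :: (real^2) set) (V :: (real^3) set) \<phi> \<psi>.
        open U \<and> open V \<and> p \<in> V \<and>
        homeomorphism U (S \<inter> V) \<phi> \<psi> \<and>
        C2_on U \<phi> \<and>
        (\<forall>u\<in>U. inj (frechet_derivative \<phi> (at u))))"

definition tangent_space :: "(real^3) set \<Rightarrow> real^3 \<Rightarrow> (real^3) set" where
  "tangent_space S p =
     {v. \<exists>e > 0. \<exists>c :: real \<Rightarrow> real^3.
        c C1_differentiable_on {-e<..<e} \<and> c ` {-e<..<e} \<subseteq> S \<and>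
        c 0 = p \<and> (c has_vector_derivative v) (at 0)}"

text \<open>Orientability of \<open>S\<close> is the existence of such a field.\<close>

definition unit_normal_field :: "(real^3) set \<Rightarrow> (real^3 \<Rightarrow> real^3) \<Rightarrow> bool" where
  "unit_normal_field S N \<longleftrightarrow>
     continuous_on S N \<and>
     (\<forall>p\<in>S. norm (N p) = 1 \<and> (\<forall>v\<in>tangent_space S p. N p \<bullet> v = 0))"

text \<open>The derivative of \<open>N\<close> within \<open>S\<close> is a linear map on the whole space that is
  determined by \<open>N\<close> on tangent vectors only, so the shape operator is meaningful only for
  \<open>v \<in> tangent_space S p\<close>.  The sign is the one for which the normal curvature of a unit-speed
  curve \<open>\<gamma>\<close> in \<open>S\<close> is
  \<open>\<gamma>'' \<bullet> N = - \<gamma>' \<bullet> (N \<circ> \<gamma>)' = \<gamma>' \<bullet> shape_operator S N p \<gamma>'\<close>.\<close>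

definition shape_operator :: "(real^3) set \<Rightarrow> (real^3 \<Rightarrow> real^3) \<Rightarrow> real^3 \<Rightarrow> real^3 \<Rightarrow> real^3" where
  "shape_operator S N p v = - frechet_derivative N (at p within S) v"

text \<open>The set \<open>{\<kappa>\<^sub>1(p), \<kappa>\<^sub>2(p)}\<close>.\<close>

definition principal_curvatures :: "(real^3) set \<Rightarrow> (real^3 \<Rightarrow> real^3) \<Rightarrow> real^3 \<Rightarrow> real set" where
  "principal_curvatures S N p =
     {k. \<exists>v\<in>tangent_space S p. v \<noteq> 0 \<and> shape_operator S N p v = k *\<^sub>R v}"

section \<open>Motions\<close>

text \<open>A curve is given on \<open>{0..l}\<close>, with one-sided derivatives at the end points.\<close>

definition unit_speed_curve :: "(real^3) set \<Rightarrow> real \<Rightarrow> (real \<Rightarrow> real^3) \<Rightarrow> bool" where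
  "unit_speed_curve S l \<gamma> \<longleftrightarrow>
     0 < l \<and> \<gamma> ` {0..l} \<subseteq> S \<and>
     (\<exists>\<gamma>' \<gamma>''.
        (\<forall>t\<in>{0..l}. (\<gamma> has_vector_derivative \<gamma>' t) (at t within {0..l}) \<and>
                    (\<gamma>' has_vector_derivative \<gamma>'' t) (at t within {0..l}) \<and>
                    norm (\<gamma>' t) = 1) \<and>
        continuous_on {0..l} \<gamma>'')"

text \<open>The library's \<^const>\<open>C1_differentiable_on\<close> uses two-sided derivatives; the following
  uses one-sided derivatives at the end points of \<open>{0..l}\<close>.\<close>

definition C1_upto :: "real \<Rightarrow> (real \<Rightarrow> 'a::real_normed_vector) \<Rightarrow> bool" where
  "C1_upto l f \<longleftrightarrow>
     (\<exists>f'. (\<forall>t\<in>{0..l}. (f has_vector_derivative f' t) (at t within {0..l})) \<and>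
           continuous_on {0..l} f')"

definition tangent_at :: "(real^3) set \<Rightarrow> (real^3) set \<Rightarrow> real^3 \<Rightarrow> bool" where
  "tangent_at M S q \<longleftrightarrow> q \<in> M \<and> q \<in> S \<and> tangent_space M q = tangent_space S q"

definition affine_motion ::
  "(real \<Rightarrow> real^3^3) \<Rightarrow> (real \<Rightarrow> real^3) \<Rightarrow> real \<Rightarrow> real^3 \<Rightarrow> real^3" where
  "affine_motion A b t x = A t *v x + b t"

definition motion_along ::
  "(real^3) set \<Rightarrow> (real^3) set \<Rightarrow> real \<Rightarrow> (real \<Rightarrow> real^3) \<Rightarrow>
   (real \<Rightarrow> real^3^3) \<Rightarrow> (real \<Rightarrow> real^3) \<Rightarrow> bool" where
  "motion_along M S l \<gamma> A b \<longleftrightarrow>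
     C1_upto l A \<and> C1_upto l b \<and>
     (\<forall>t\<in>{0..l}. rotation_matrix (A t)) \<and>
     affine_motion A b 0 = id \<and>
     (\<forall>t\<in>{0..l}. tangent_at (affine_motion A b t ` M) S (\<gamma> t))"

definition instantaneous_motion ::
  "real \<Rightarrow> (real \<Rightarrow> real^3^3) \<Rightarrow> (real \<Rightarrow> real^3) \<Rightarrow> real \<Rightarrow> real^3 \<Rightarrow> real^3" where
  "instantaneous_motion l A b t x =
     vector_derivative (\<lambda>s. affine_motion A b s (inv (affine_motion A b t) x)) (at t within {0..l})"

text \<open>The linear part \<open>Q\<^sub>t\<close> of the instantaneous motion.\<close>

definition infinitesimal_rotation :: "real \<Rightarrow> (real \<Rightarrow> real^3^3) \<Rightarrow> real \<Rightarrow> real^3^3" where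
  "infinitesimal_rotation l A t =
     vector_derivative A (at t within {0..l}) ** transpose (A t)"

text \<open>The vector exists and is unique because \<open>Q\<^sub>t\<close> is skew-symmetric whenever \<open>A\<close> is
  a differentiable path of rotations.\<close>

definition angular_velocity :: "real \<Rightarrow> (real \<Rightarrow> real^3^3) \<Rightarrow> real \<Rightarrow> real^3" where
  "angular_velocity l A t =
     (THE w. \<forall>x. infinitesimal_rotation l A t *v x = cross3 w x)"

definition rotational_motion ::
  "(real^3) set \<Rightarrow> (real^3) set \<Rightarrow> real \<Rightarrow> (real \<Rightarrow> real^3) \<Rightarrow>
   (real \<Rightarrow> real^3^3) \<Rightarrow> (real \<Rightarrow> real^3) \<Rightarrow> bool" where
  "rotational_motion M S l \<gamma> A b \<longleftrightarrow>
     motion_along M S l \<gamma> A b \<and>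
     (\<forall>t\<in>{0..l}. infinitesimal_rotation l A t \<noteq> 0 \<and>
                 instantaneous_motion l A b t (\<gamma> t) = 0)"

definition rolling ::
  "(real^3) set \<Rightarrow> (real^3) set \<Rightarrow> real \<Rightarrow> (real \<Rightarrow> real^3) \<Rightarrow>
   (real \<Rightarrow> real^3^3) \<Rightarrow> (real \<Rightarrow> real^3) \<Rightarrow> bool" where
  "rolling M S l \<gamma> A b \<longleftrightarrow>
     rotational_motion M S l \<gamma> A b \<and>
     (\<forall>t\<in>{0..l}. angular_velocity l A t \<in> tangent_space S (\<gamma> t))"

section \<open>Isotropic rolling\<close>

definition ball_center :: "(real^3 \<Rightarrow> real^3) \<Rightarrow> real \<Rightarrow> real^3 \<Rightarrow> real^3" where
  "ball_center N r p = p + r *\<^sub>R N p"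

definition ball_rolls ::
  "(real^3) set \<Rightarrow> (real^3 \<Rightarrow> real^3) \<Rightarrow> real \<Rightarrow> real \<Rightarrow> (real \<Rightarrow> real^3) \<Rightarrow>
   (real \<Rightarrow> real^3^3) \<Rightarrow> (real \<Rightarrow> real^3) \<Rightarrow> bool" where
  "ball_rolls S N r l \<gamma> A b \<longleftrightarrow>
     rolling (sphere (ball_center N r (\<gamma> 0)) \<bar>r\<bar>) S l \<gamma> A b"

text \<open>The length of the velocity of the center \<open>c\<close> at time \<open>t\<close>.\<close>

definition ball_speed ::
  "real \<Rightarrow> (real \<Rightarrow> real^3^3) \<Rightarrow> (real \<Rightarrow> real^3) \<Rightarrow> real^3 \<Rightarrow> real \<Rightarrow> real" where
  "ball_speed l A b c t =
     norm (vector_derivative (\<lambda>s. affine_motion A b s c) (at t within {0..l}))"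

definition rolls_isotropically ::
  "(real^3) set \<Rightarrow> (real^3 \<Rightarrow> real^3) \<Rightarrow> real \<Rightarrow> real^3 \<Rightarrow> bool" where
  "rolls_isotropically S N r p \<longleftrightarrow>
     (\<exists>\<sigma>. \<forall>v\<in>tangent_space S p. norm v = 1 \<longrightarrow>
        (\<forall>l \<gamma>. unit_speed_curve S l \<gamma> \<and> \<gamma> 0 = p \<and>
               (\<gamma> has_vector_derivative v) (at 0 within {0..l}) \<longrightarrow>
           (\<exists>e A b. 0 < e \<and> e \<le> l \<and> ball_rolls S N r e \<gamma> A b \<and>
                    ball_speed e A b (ball_center N r p) 0 = \<sigma>)))"

end

theory Submission
  imports Defs
begin

text \<open>
  Everything rests on the path of the center of the ball.  Tangency forces the center at time
  \<open>t\<close> to be \<open>\<gamma> t + r N (\<gamma> t)\<close> (lemma \<open>center_of_sphere_moved_along\<close>), so along a curve that starts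
  in the direction \<open>v\<close> its initial velocity is \<open>(I - r A) v\<close>, where \<open>A\<close> is the shape
  operator at the starting point.  Isotropic rolling therefore means that \<open>I - r A\<close>
  has the same length \<open>\<sigma>\<close> on all unit tangent vectors.

  Suppose that the ball rolls isotropically from every point.  As \<open>A\<close> is self-adjoint,
  \<open>(I - r A)\<^sup>2 = \<sigma>\<^sup>2 I\<close>, so the eigenvalues of \<open>I - r A\<close> are \<open>\<sigma>\<close> or
  \<open>- \<sigma>\<close>.  The bound on the principal curvatures makes them positive; without it the two signs
  could occur together.  Hence \<open>I - r A = \<sigma> I\<close> and every point is umbilic (lemma
  \<open>isotropic_imp_umbilic\<close>).

  It remains to see that a compact connected umbilic surface is a sphere.  The normal of a
  \<open>C\<^sup>2\<close> surface is only once differentiable, so the usual argument, which differentiates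
  \<open>dN = \<mu> I\<close> again, is not available.  Instead, the surface is written near
  a point as a graph over a plane.  In this chart the projection of \<open>N\<close> to the plane is a map
  whose derivative is \<open>\<mu> I\<close>, and its two components show that \<open>\<mu>\<close> depends on neither
  coordinate (lemma \<open>conformal_factor_constant\<close>).  So \<open>\<mu>\<close> and \<open>N - \<mu> q\<close> are
  constant, and studying highest points in suitable directions identifies \<open>S\<close> with a
  sphere (lemma \<open>compact_umbilic_surface_is_sphere\<close>).

  Conversely, on a sphere \<open>N\<close> is a constant multiple \<open>k\<close> of the radius vector, and the center
  of the ball moves on a homothetic copy of the curve, with speed \<open>1 + r k\<close> in every
  direction; the curvature bound makes this number positive.  What has to be
  constructed is the rolling itself: the angular velocity is determined by the curve, and the
  rotations are obtained from it by solving a linear differential equation (lemma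
  \<open>ball_rolls_on_sphere\<close>).\<close>

section \<open>Three tools from analysis\<close>

text \<open>The second difference of \<open>f\<close> over the parallelogram spanned by \<open>t v\<close> and \<open>t w\<close> is
  symmetric in \<open>v\<close> and \<open>w\<close>.  Two applications of the mean value theorem turn it into
  \<open>t\<^sup>2\<close> times the second derivative at an intermediate point, and continuity of \<open>f''\<close> lets
  \<open>t\<close> tend to \<open>0\<close>.  Pairing with the fixed vector \<open>c\<close>, the defect of symmetry itself,
  reduces everything to real-valued functions.\<close>

lemma symmetric_second_derivative:
  fixes f :: "'a::real_normed_vector \<Rightarrow> 'b::real_inner"
    and f' :: "'a \<Rightarrow> 'a \<Rightarrow>\<^sub>L 'b" and f'' :: "'a \<Rightarrow> 'a \<Rightarrow>\<^sub>L ('a \<Rightarrow>\<^sub>L 'b)"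
  assumes "open U" "x \<in> U"
    and f': "\<And>y. y \<in> U \<Longrightarrow> (f has_derivative f' y) (at y)"
    and f'': "\<And>y. y \<in> U \<Longrightarrow> (f' has_derivative f'' y) (at y)"
    and cont: "continuous_on U f''"
  shows "f'' x v w = f'' x w v"
proof -
  define c where "c = f'' x v w - f'' x w v"
  define \<Delta> where "\<Delta> a b t = c \<bullet> (f (x + t *\<^sub>R a + t *\<^sub>R b) - f (x + t *\<^sub>R a) - f (x + t *\<^sub>R b) + f x)"
    for a b :: 'a and t :: real
  obtain d where d: "d > 0" "ball x d \<subseteq> U"
    using \<open>open U\<close> \<open>x \<in> U\<close> openE by blast
  have \<Delta>: "\<exists>y. norm (y - x) \<le> t * (norm a + norm b) \<and> \<Delta> a b t = t\<^sup>2 * (c \<bullet> f'' y a b)"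
    if t: "0 < t" "t * (norm a + norm b) < d" for a b t
  proof -
    have near: "norm (s *\<^sub>R a + u *\<^sub>R b) \<le> t * (norm a + norm b)"
      if "0 \<le> s" "s \<le> t" "0 \<le> u" "u \<le> t" for s u
    proof -
      have "norm (s *\<^sub>R a + u *\<^sub>R b) \<le> s * norm a + u * norm b"
        using that by (metis abs_of_nonneg norm_scaleR norm_triangle_ineq)
      also have "\<dots> \<le> t * norm a + t * norm b"
        using that by (intro add_mono mult_right_mono) auto
      finally show ?thesis by (simp add: algebra_simps)
    qed
    have inU: "x + s *\<^sub>R a + u *\<^sub>R b \<in> U" if "0 \<le> s" "s \<le> t" "0 \<le> u" "u \<le> t" for s u
    proof -
      have "dist x (x + s *\<^sub>R a + u *\<^sub>R b) = norm (s *\<^sub>R a + u *\<^sub>R b)"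
        by (metis add.assoc add_diff_cancel_left' dist_norm norm_minus_commute)
      then show ?thesis using near[OF that] t d by auto
    qed
    have D1: "((\<lambda>u. c \<bullet> (f (x + t *\<^sub>R a + u *\<^sub>R b) - f (x + u *\<^sub>R b)))
        has_real_derivative c \<bullet> (f' (x + t *\<^sub>R a + u *\<^sub>R b) b - f' (x + u *\<^sub>R b) b)) (at u)"
      if "0 \<le> u" "u \<le> t" for u
    proof -
      have *: "((\<lambda>u. f (x + s *\<^sub>R a + u *\<^sub>R b)) has_derivative (\<lambda>h. f' (x + s *\<^sub>R a + u *\<^sub>R b) (h *\<^sub>R b))) (at u)"
        if "0 \<le> s" "s \<le> t" for s
        by (rule has_derivative_compose[where g = f and f = "\<lambda>u. x + s *\<^sub>R a + u *\<^sub>R b", OF _ f'[OF inU]])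
          (use that \<open>0 \<le> u\<close> \<open>u \<le> t\<close> in \<open>auto intro!: derivative_eq_intros\<close>)
      show ?thesis
        unfolding has_field_derivative_def
        using *[of t] *[of 0] t
        by (auto intro!: derivative_eq_intros simp: blinfun.scaleR_right inner_diff_right algebra_simps)
    qed
    obtain u where u: "0 < u" "u < t"
      "\<Delta> a b t = t * (c \<bullet> (f' (x + t *\<^sub>R a + u *\<^sub>R b) b - f' (x + u *\<^sub>R b) b))"
      using MVT2[OF t(1) D1] by (auto simp: \<Delta>_def algebra_simps)
    have D2: "((\<lambda>s. c \<bullet> f' (x + s *\<^sub>R a + u *\<^sub>R b) b)
        has_real_derivative c \<bullet> f'' (x + s *\<^sub>R a + u *\<^sub>R b) a b) (at s)"
      if "0 \<le> s" "s \<le> t" for s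
    proof -
      have *: "((\<lambda>s. f' (x + s *\<^sub>R a + u *\<^sub>R b)) has_derivative (\<lambda>h. f'' (x + s *\<^sub>R a + u *\<^sub>R b) (h *\<^sub>R a))) (at s)"
        by (rule has_derivative_compose[where g = f' and f = "\<lambda>s. x + s *\<^sub>R a + u *\<^sub>R b", OF _ f''[OF inU]])
          (use that u in \<open>auto intro!: derivative_eq_intros\<close>)
      show ?thesis
        unfolding has_field_derivative_def
        by (rule derivative_eq_intros * refl | simp add: blinfun.scaleR_right blinfun.scaleR_left inner_diff_right algebra_simps mult_commute_abs)+
    qed
    obtain s where s: "0 < s" "s < t"
      "c \<bullet> f' (x + t *\<^sub>R a + u *\<^sub>R b) b - c \<bullet> f' (x + 0 *\<^sub>R a + u *\<^sub>R b) b = t * (c \<bullet> f'' (x + s *\<^sub>R a + u *\<^sub>R b) a b)"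
      using MVT2[OF t(1) D2] by auto
    show ?thesis
      by (rule exI[of _ "x + s *\<^sub>R a + u *\<^sub>R b"])
        (use near[of s u] s u in \<open>auto simp: inner_diff_right power2_eq_square add.assoc\<close>)
  qed
  have "\<bar>c \<bullet> f'' x v w - c \<bullet> f'' x w v\<bar> \<le> e" if "e > 0" for e :: real
  proof -
    have cc: "\<exists>\<delta>>0. \<forall>y. dist y x < \<delta> \<longrightarrow> dist (c \<bullet> f'' y a b) (c \<bullet> f'' x a b) < e / 2" for a b
    proof -
      have "isCont f'' x" using cont \<open>open U\<close> \<open>x \<in> U\<close> continuous_on_eq_continuous_at by blast
      then have "isCont (\<lambda>y. c \<bullet> f'' y a b) x" by (intro continuous_intros)
      then show ?thesis using \<open>e > 0\<close> unfolding continuous_at_eps_delta by (meson half_gt_zero)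
    qed
    obtain d1 d2 where d12: "d1 > 0" "d2 > 0"
      "\<And>y. dist y x < d1 \<Longrightarrow> dist (c \<bullet> f'' y v w) (c \<bullet> f'' x v w) < e / 2"
      "\<And>y. dist y x < d2 \<Longrightarrow> dist (c \<bullet> f'' y w v) (c \<bullet> f'' x w v) < e / 2"
      using cc[of v w] cc[of w v] by blast
    define m where "m = min d (min d1 d2)"
    define t where "t = m / (2 * (norm v + norm w + 1))"
    have m: "m > 0" "m \<le> d" "m \<le> d1" "m \<le> d2" using d d12 by (auto simp: m_def)
    have n1: "norm v + norm w + 1 > 0" by (simp add: add_nonneg_pos)
    have t: "t > 0" using m n1 by (simp add: t_def)
    have "t * (norm v + norm w) \<le> t * (norm v + norm w + 1)" using t by simp
    also have "\<dots> = m / 2" using n1 by (simp add: t_def field_simps)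
    finally have tm: "t * (norm v + norm w) < m" using m by simp
    obtain y where y: "norm (y - x) \<le> t * (norm v + norm w)" "\<Delta> v w t = t\<^sup>2 * (c \<bullet> f'' y v w)"
      using \<Delta>[of t v w] t tm m by auto
    obtain z where z: "norm (z - x) \<le> t * (norm w + norm v)" "\<Delta> w v t = t\<^sup>2 * (c \<bullet> f'' z w v)"
      using \<Delta>[of t w v] t tm m by (auto simp: add.commute)
    have "\<Delta> v w t = \<Delta> w v t" by (simp add: \<Delta>_def algebra_simps)
    then have "c \<bullet> f'' y v w = c \<bullet> f'' z w v" using y z t by simp
    moreover have "dist (c \<bullet> f'' y v w) (c \<bullet> f'' x v w) < e / 2"
      using y tm m by (intro d12) (auto simp: dist_norm)
    moreover have "dist (c \<bullet> f'' z w v) (c \<bullet> f'' x w v) < e / 2"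
      using z tm m by (intro d12) (auto simp: dist_norm add.commute)
    ultimately show ?thesis by (simp add: dist_real_def) argo
  qed
  then have "c \<bullet> f'' x v w - c \<bullet> f'' x w v = 0" using field_le_epsilon[of "\<bar>c \<bullet> f'' x v w - c \<bullet> f'' x w v\<bar>" 0] by auto
  then have "c \<bullet> c = 0" by (simp add: c_def inner_diff_right)
  then show ?thesis by (simp add: c_def)
qed

text \<open>This takes the place of the Codazzi equations for surfaces whose normal can be
  differentiated only once.  The component \<open>H\<^sub>i\<close> has vanishing derivative in the direction
  of the other coordinate axis, so it is unchanged by shifts along that axis; hence so is its
  derivative along the \<open>i\<close>-th axis, which is \<open>\<mu>\<close>.  As this holds for both axes,
  any two points of the box are joined by two shifts that preserve \<open>\<mu>\<close>.\<close>

lemma conformal_factor_constant: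
  fixes H :: "real^2 \<Rightarrow> real^2" and \<mu> :: "real^2 \<Rightarrow> real"
  assumes der: "\<And>y. y \<in> box a b \<Longrightarrow> (H has_derivative (\<lambda>w. \<mu> y *\<^sub>R w)) (at y)"
    and "y \<in> box a b" "z \<in> box a b"
  shows "\<mu> y = \<mu> z"
proof -
  have line: "((\<lambda>t. H (p + t *\<^sub>R axis k 1) $ i) has_real_derivative (\<mu> (p + t *\<^sub>R axis k 1) * axis k 1 $ i)) (at t)"
    if "p + t *\<^sub>R axis k 1 \<in> box a b" for p t k i
  proof -
    have "((\<lambda>t. H (p + t *\<^sub>R axis k 1)) has_derivative (\<lambda>h. \<mu> (p + t *\<^sub>R axis k 1) *\<^sub>R (h *\<^sub>R axis k 1))) (at t)"
      by (rule has_derivative_compose[where g = H and f = "\<lambda>t. p + t *\<^sub>R axis k 1", OF _ der[OF that]]) (auto intro!: derivative_eq_intros)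
    from has_derivative_compose[OF this bounded_linear_imp_has_derivative[OF bounded_linear_vec_nth[of i]]]
    show ?thesis by (simp add: has_field_derivative_def mult.commute mult.left_commute mult_commute_abs)
  qed
  have const: "H (p + s *\<^sub>R axis k 1) $ i = H p $ i"
    if "i \<noteq> k" and p: "p \<in> box a b" "p + s *\<^sub>R axis k 1 \<in> box a b" for p s k i
  proof -
    have seg: "p + t *\<^sub>R axis k 1 \<in> box a b" if t: "t \<in> closed_segment 0 s" for t
    proof -
      obtain u where u: "0 \<le> u" "u \<le> 1" "t = u * s"
        using t by (auto simp: closed_segment_def)
      have "p + t *\<^sub>R axis k 1 = (1 - u) *\<^sub>R p + u *\<^sub>R (p + s *\<^sub>R axis k 1)"
        by (simp add: u algebra_simps)
      then show ?thesis using convexD[OF convex_box(2) p, of "1 - u" u] u by simp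
    qed
    have "((\<lambda>t. H (p + t *\<^sub>R axis k 1) $ i) has_derivative (\<lambda>h. 0)) (at t within closed_segment 0 s)"
      if "t \<in> closed_segment 0 s" for t
      using line[OF seg[OF that], of i] \<open>i \<noteq> k\<close>
      by (auto simp: axis_def has_field_derivative_def lambda_zero[symmetric] intro: has_derivative_at_withinI)
    from has_derivative_zero_unique[OF convex_closed_segment this, of s 0] show ?thesis by simp
  qed
  have shift: "\<mu> p = \<mu> (p + s *\<^sub>R axis k 1)"
    if "i \<noteq> k" and p: "p \<in> box a b" "p + s *\<^sub>R axis k 1 \<in> box a b" for p s i k
  proof -
    define q where "q = p + s *\<^sub>R axis k 1"
    have "open ((\<lambda>t. p + t *\<^sub>R axis i 1) -` box a b \<inter> (\<lambda>t. q + t *\<^sub>R axis i 1) -` box a b)"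
      (is "open ?T") by (intro open_Int continuous_open_vimage open_box continuous_intros)
    moreover have "0 \<in> ?T" using p by (simp add: q_def)
    ultimately have ev: "\<forall>\<^sub>F t in nhds 0. H (q + t *\<^sub>R axis i 1) $ i = H (p + t *\<^sub>R axis i 1) $ i"
      unfolding eventually_nhds
    proof (intro exI[of _ ?T] conjI ballI)
      fix t assume "t \<in> ?T"
      then show "H (q + t *\<^sub>R axis i 1) $ i = H (p + t *\<^sub>R axis i 1) $ i"
        using const[OF \<open>i \<noteq> k\<close>, of "p + t *\<^sub>R axis i 1" s] by (simp add: q_def algebra_simps)
    qed auto
    have "((\<lambda>t. H (p + t *\<^sub>R axis i 1) $ i) has_real_derivative \<mu> p) (at 0)"
      using line[of p 0 i i] p by (simp add: axis_def)
    moreover have "((\<lambda>t. H (q + t *\<^sub>R axis i 1) $ i) has_real_derivative \<mu> q) (at 0)"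
      using line[of q 0 i i] p by (simp add: axis_def q_def)
    ultimately show ?thesis
      using DERIV_cong_ev[OF refl ev refl] DERIV_unique q_def by metis
  qed
  define c where "c = y + (z $ 1 - y $ 1) *\<^sub>R axis 1 1"
  have c: "c $ 1 = z $ 1" "c $ 2 = y $ 2" by (auto simp: c_def axis_def)
  have cbox: "c \<in> box a b"
    using assms(2,3) c by (auto simp: mem_box_cart forall_2)
  have zc: "z = c + (z $ 2 - y $ 2) *\<^sub>R axis 2 1"
    using c by (auto simp: vec_eq_iff forall_2 axis_def)
  have "\<mu> y = \<mu> c" using shift[of 2 1 y "z $ 1 - y $ 1"] assms(2) cbox by (simp add: c_def)
  also have "\<mu> c = \<mu> z" using shift[of 1 2 c "z $ 2 - y $ 2"] assms(3) cbox zc by simp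
  finally show ?thesis .
qed

text \<open>Picard's iteration: on an interval whose length is at most half the inverse of the size of the
  coefficients, the integral operator halves distances.\<close>

lemma linear_ode_local_solution:
  fixes P :: "'b::real_normed_vector \<Rightarrow> 'a::banach \<Rightarrow> 'a" and q :: "real \<Rightarrow> 'b"
  assumes P: "bounded_bilinear P" and "0 < l" and cont: "continuous_on {0..l} q"
  obtains e where "0 < e" "e \<le> l"
    "\<And>y0. \<exists>y. y 0 = y0 \<and> (\<forall>t\<in>{0..e}. (y has_vector_derivative P (q t) (y t)) (at t within {0..e}))"
proof -
  interpret P: bounded_bilinear P by (rule P)
  obtain K0 where K0: "K0 > 0" "\<And>a b. norm (P a b) \<le> norm a * norm b * K0"
    using P.pos_bounded by blast
  have "bounded (q ` {0..l})"
    using compact_continuous_image[OF cont] compact_imp_bounded by blast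
  then obtain K1 where K1: "K1 > 0" "\<And>t. t \<in> {0..l} \<Longrightarrow> norm (q t) \<le> K1"
    unfolding bounded_pos by auto
  define K where "K = K1 * K0"
  have K: "K > 0" "norm (P (q t) x) \<le> K * norm x" if "t \<in> {0..l}" for t x
  proof -
    show "K > 0" using K0 K1 by (simp add: K_def)
    have "norm (P (q t) x) \<le> norm (q t) * norm x * K0" by (rule K0)
    also have "\<dots> \<le> K1 * norm x * K0" using K0 K1 that by (intro mult_right_mono) auto
    finally show "norm (P (q t) x) \<le> K * norm x" by (simp add: K_def mult_ac)
  qed
  have "K > 0" using K0 K1 by (simp add: K_def)
  define e where "e = min l (1 / (2 * K))"
  have e: "0 < e" "e \<le> l" "e * K \<le> 1 / 2"
    using \<open>0 < l\<close> \<open>K > 0\<close> by (auto simp: e_def min_def field_simps)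
  \<comment> \<open>Clamping the time to \<open>{0..e}\<close> makes all iterates bounded continuous functions on the whole line, which form a complete space.\<close>
  define cl where "cl t = max 0 (min e t)" for t :: real
  have cl: "cl t \<in> {0..e}" for t using e by (auto simp: cl_def)
  have contcl: "continuous_on UNIV cl" unfolding cl_def by (intro continuous_intros)
  have "\<exists>y. y 0 = y0 \<and> (\<forall>t\<in>{0..e}. (y has_vector_derivative P (q t) (y t)) (at t within {0..e}))" for y0
  proof -
    define I where "I f t = y0 + integral {0..t} (\<lambda>s. P (q s) (apply_bcontfun f s))" for f :: "real \<Rightarrow>\<^sub>C 'a" and t
    have contQ: "continuous_on {0..e} (\<lambda>s. P (q s) (apply_bcontfun f s))" for f :: "real \<Rightarrow>\<^sub>C 'a"
      by (intro P.continuous_on continuous_intros continuous_on_subset[OF cont]) (use e in auto)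
    have integ: "(\<lambda>s. P (q s) (apply_bcontfun f s)) integrable_on {0..t}" if "t \<le> e" for f :: "real \<Rightarrow>\<^sub>C 'a" and t
      by (rule integrable_continuous_real[OF continuous_on_subset[OF contQ]]) (use that in auto)
    have contI: "continuous_on {0..e} (I f)" for f
      unfolding I_def using integ[of e f]
      by (intro continuous_intros indefinite_integral_continuous_1) auto
    have bc: "(\<lambda>t. I f (cl t)) \<in> bcontfun" for f
    proof -
      have "continuous_on UNIV (\<lambda>t. I f (cl t))"
        by (rule continuous_on_compose2[OF contI contcl]) (use cl in auto)
      moreover have "bounded (range (\<lambda>t. I f (cl t)))"
        by (rule bounded_subset[OF compact_imp_bounded[OF compact_continuous_image[OF contI]]])
          (use cl in auto)
      ultimately show ?thesis by (simp add: bcontfun_def)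
    qed
    define T where "T f = Bcontfun (\<lambda>t. I f (cl t))" for f
    have T: "apply_bcontfun (T f) t = I f (cl t)" for f t
      by (simp add: T_def Bcontfun_inverse[OF bc])
    have "dist (T f) (T g) \<le> 1 / 2 * dist f g" for f g
    proof (rule dist_bound)
      fix t
      have "norm (integral {0..cl t} (\<lambda>s. P (q s) (apply_bcontfun f s - apply_bcontfun g s)))
            \<le> (K * dist f g) * (cl t - 0)"
      proof (rule integral_bound)
        show "0 \<le> cl t" using cl by auto
        show "continuous_on {0..cl t} (\<lambda>s. P (q s) (apply_bcontfun f s - apply_bcontfun g s))"
          by (intro P.continuous_on continuous_intros continuous_on_subset[OF cont]) (use cl[of t] e in auto)
        fix s assume s: "s \<in> {0..cl t}"
        have "norm (P (q s) (apply_bcontfun f s - apply_bcontfun g s)) \<le> K * norm (apply_bcontfun f s - apply_bcontfun g s)"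
          by (rule K(2)) (use s cl[of t] e in auto)
        also have "\<dots> \<le> K * dist f g"
          using \<open>K > 0\<close> dist_bounded[of f s g] by (intro mult_left_mono) (auto simp: dist_norm)
        finally show "norm (P (q s) (apply_bcontfun f s - apply_bcontfun g s)) \<le> K * dist f g" .
      qed
      also have "\<dots> \<le> (K * dist f g) * e"
        using cl[of t] \<open>K > 0\<close> by (intro mult_left_mono) auto
      also have "\<dots> = (e * K) * dist f g" by simp
      also have "\<dots> \<le> 1 / 2 * dist f g" using e by (intro mult_right_mono) auto
      finally show "dist (apply_bcontfun (T f) t) (apply_bcontfun (T g) t) \<le> 1 / 2 * dist f g"
        using cl[of t] by (simp add: T I_def dist_norm P.diff_right integral_diff integ)
    qed
    then have "\<exists>!f. T f = f" by (intro banach_fix_type[of "1/2"]) auto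
    then obtain f where f: "T f = f" by blast
    have fI: "apply_bcontfun f t = I f t" if "t \<in> {0..e}" for t
      using T[of f t] that by (simp add: f cl_def)
    show ?thesis
    proof (intro exI[of _ "I f"] conjI ballI)
      show "I f 0 = y0" by (simp add: I_def)
      fix t assume t: "t \<in> {0..e}"
      have "(I f has_vector_derivative 0 + P (q t) (apply_bcontfun f t)) (at t within {0..e})"
        unfolding I_def
        by (intro derivative_intros integral_has_vector_derivative contQ t)
      then show "(I f has_vector_derivative P (q t) (I f t)) (at t within {0..e})"
        using fI[OF t] by simp
    qed
  qed
  then show thesis using that e by blast
qed

section \<open>Charts and tangent planes\<close>

lemma bounded_bilinear_cross3: "bounded_bilinear cross3"
  using bilinear_conv_bounded_bilinear bilinear_cross by blast

lemmas cross3_derivative = bounded_bilinear.FDERIV[OF bounded_bilinear_cross3]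

text \<open>A derivative of \<open>f\<close> within \<open>S\<close> is not unique, but its values on velocities of
  curves in \<open>S\<close> are; this and the next fact make the shape operator computable from any
  such derivative.\<close>

lemma has_derivative_along_tangent:
  assumes c: "c C1_differentiable_on {-e<..<e}" "c ` {-e<..<e} \<subseteq> S" "c 0 = p" "e > 0"
    "(c has_vector_derivative v) (at 0)"
    and f: "(f has_derivative D) (at p within S)"
  shows "((\<lambda>t. f (c t)) has_vector_derivative D v) (at 0)"
proof -
  have "((\<lambda>t. f (c t)) has_vector_derivative D v) (at 0 within {-e<..<e})"
  proof -
    have c1: "(c has_derivative (\<lambda>h. h *\<^sub>R v)) (at 0 within {-e<..<e})"
      using c(5) by (auto simp: has_vector_derivative_def intro: has_derivative_at_withinI)
    have f1: "(f has_derivative D) (at (c 0) within c ` {-e<..<e})"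
      using f c by (auto intro: has_derivative_subset)
    have "bounded_linear D" using f has_derivative_bounded_linear by blast
    then show ?thesis
      using has_derivative_in_compose[OF c1 f1]
      by (simp add: has_vector_derivative_def linear_simps)
  qed
  then show ?thesis using c(4) by (simp add: at_within_open[of 0 "{-e<..<e}"])
qed

lemma frechet_derivative_tangent:
  assumes f: "(f has_derivative D) (at p within S)" and v: "v \<in> tangent_space S p"
  shows "frechet_derivative f (at p within S) v = D v"
proof -
  obtain e c where c: "e > 0" "c C1_differentiable_on {-e<..<e}" "c ` {-e<..<e} \<subseteq> S" "c 0 = p"
    "(c has_vector_derivative v) (at (0::real))"
    using v by (auto simp: tangent_space_def)
  have "(f has_derivative frechet_derivative f (at p within S)) (at p within S)"
    using f by (auto simp: differentiable_def frechet_derivative_works[symmetric])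
  from vector_derivative_unique_at[OF
      has_derivative_along_tangent[OF c(2,3,4,1,5) this]
      has_derivative_along_tangent[OF c(2,3,4,1,5) f]]
  show ?thesis .
qed

text \<open>Stated without division, so that \<open>a\<close> and \<open>b\<close> may be dependent; it follows from
  expanding \<open>(a \<times> b) \<times> (n \<times> (a \<times> b)) = 0\<close>.\<close>

lemma parallel_if_orthogonal_to_both:
  fixes n a b :: "real^3"
  assumes "n \<bullet> a = 0" "n \<bullet> b = 0"
  shows "(cross3 a b \<bullet> cross3 a b) *\<^sub>R n = (n \<bullet> cross3 a b) *\<^sub>R cross3 a b"
proof -
  have "cross3 n (cross3 a b) = 0" using assms by (simp add: Lagrange)
  then have "cross3 (cross3 a b) (cross3 n (cross3 a b)) = 0" by simp
  then show ?thesis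
    unfolding Lagrange[of "cross3 a b" n "cross3 a b"] by (simp add: inner_commute)
qed

text \<open>A chart of a surface with a unit normal field, with explicit first and second derivatives.
  The last two assumptions identify the image of the derivative and the set of
  velocities of curves with the orthogonal complement of the normal; nearly every later argument
  starts from them.\<close>

locale surface_chart =
  fixes S :: "(real^3) set" and N :: "real^3 \<Rightarrow> real^3"
    and U :: "(real^2) set" and V :: "(real^3) set"
    and \<phi> :: "real^2 \<Rightarrow> real^3" and \<psi> :: "real^3 \<Rightarrow> real^2"
    and \<phi>' :: "real^2 \<Rightarrow> (real^2) \<Rightarrow>\<^sub>L (real^3)"
    and \<phi>'' :: "real^2 \<Rightarrow> (real^2) \<Rightarrow>\<^sub>L ((real^2) \<Rightarrow>\<^sub>L (real^3))"
  assumes normal: "unit_normal_field S N"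
    and open_dom: "open U" and open_cod: "open V"
    and homeo: "homeomorphism U (S \<inter> V) \<phi> \<psi>"
    and deriv: "\<And>u. u \<in> U \<Longrightarrow> (\<phi> has_derivative \<phi>' u) (at u)"
    and deriv2: "\<And>u. u \<in> U \<Longrightarrow> (\<phi>' has_derivative \<phi>'' u) (at u)"
    and continuous_deriv2: "continuous_on U \<phi>''"
    and immersion: "\<And>u. u \<in> U \<Longrightarrow> inj (\<phi>' u)"
    and range_deriv: "\<And>u. u \<in> U \<Longrightarrow> range (\<phi>' u) = {v. N (\<phi> u) \<bullet> v = 0}"
    and tangent_space_chart: "\<And>u. u \<in> U \<Longrightarrow> tangent_space S (\<phi> u) = {v. N (\<phi> u) \<bullet> v = 0}"
begin

lemma chart_in_surface: "u \<in> U \<Longrightarrow> \<phi> u \<in> S" "u \<in> U \<Longrightarrow> \<phi> u \<in> V"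
  using homeo by (auto simp: homeomorphism_def)

lemma inverse_chart: "q \<in> S \<Longrightarrow> q \<in> V \<Longrightarrow> \<psi> q \<in> U" "q \<in> S \<Longrightarrow> q \<in> V \<Longrightarrow> \<phi> (\<psi> q) = q"
  using homeo by (auto simp: homeomorphism_def)

lemma continuous_deriv: "continuous_on U \<phi>'"
  by (intro continuous_at_imp_continuous_on ballI) (use deriv2 has_derivative_continuous in blast)

lemma continuous_chart: "continuous_on U \<phi>"
  using homeo by (auto simp: homeomorphism_def)

lemma norm_normal: "u \<in> U \<Longrightarrow> norm (N (\<phi> u)) = 1"
  using normal chart_in_surface by (auto simp: unit_normal_field_def)

lemma normal_orthogonal_deriv: "u \<in> U \<Longrightarrow> N (\<phi> u) \<bullet> \<phi>' u w = 0"
  using range_deriv by blast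

end

text \<open>The images of straight lines are curves in \<open>S\<close>, so the range of the derivative lies in the
  set of velocities, which lies in the orthogonal complement of the normal.  The
  two outer spaces are planes, hence all three coincide: comparing dimensions takes the place of
  lifting a curve in \<open>S\<close> differentiably to the chart.\<close>

lemma surface_chart_exists:
  assumes S: "C2_surface S" and N: "unit_normal_field S N" and p: "p \<in> S"
  obtains U V \<phi> \<psi> \<phi>' \<phi>'' where "surface_chart S N U V \<phi> \<psi> \<phi>' \<phi>''" "p \<in> V"
using bspec[OF S[unfolded C2_surface_def] p]
proof (elim exE conjE)
  fix U :: "(real^2) set" and V \<phi> \<psi>
  assume c: "open U" "open V" "p \<in> V" "homeomorphism U (S \<inter> V) \<phi> \<psi>"
    "C2_on U \<phi>" "\<forall>u\<in>U. inj (frechet_derivative \<phi> (at u))"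
  obtain \<phi>' :: "real^2 \<Rightarrow> (real^2) \<Rightarrow>\<^sub>L (real^3)" and \<phi>'' where d:
    "\<And>u. u \<in> U \<Longrightarrow> (\<phi> has_derivative \<phi>' u) (at u)"
    "\<And>u. u \<in> U \<Longrightarrow> (\<phi>' has_derivative blinfun_apply (\<phi>'' u)) (at u)"
    "continuous_on U \<phi>''"
    using c(5) unfolding C2_on_def by blast
  have inj: "inj (\<phi>' u)" if "u \<in> U" for u
    using c(6) that frechet_derivative_at[OF d(1)[OF that]] by auto
  have cont: "continuous_on U \<phi>'"
    by (intro continuous_at_imp_continuous_on ballI) (use d(2) has_derivative_continuous in blast)
  have img: "\<phi> u \<in> S" if "u \<in> U" for u
    using c(4) that by (auto simp: homeomorphism_def)
  have sub: "range (\<phi>' u) \<subseteq> tangent_space S (\<phi> u)" if u: "u \<in> U" for u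
  proof
    fix v assume "v \<in> range (\<phi>' u)"
    then obtain w where w: "v = \<phi>' u w" by blast
    have "open ((\<lambda>t::real. u + t *\<^sub>R w) -` U)"
      by (intro continuous_open_vimage \<open>open U\<close> continuous_intros)
    then obtain e where e: "e > 0" "ball 0 e \<subseteq> (\<lambda>t::real. u + t *\<^sub>R w) -` U"
      using u by (metis (no_types, lifting) add.right_neutral openE scale_zero_left vimageI)
    have inU: "u + t *\<^sub>R w \<in> U" if "t \<in> {-e<..<e}" for t
      using e that by (auto simp: subset_iff dist_real_def)
    have d: "((\<lambda>t. \<phi> (u + t *\<^sub>R w)) has_vector_derivative \<phi>' (u + t *\<^sub>R w) w) (at t)"
      if "t \<in> {-e<..<e}" for t
    proof -
      have "((\<lambda>t. \<phi> (u + t *\<^sub>R w)) has_derivative (\<lambda>h. \<phi>' (u + t *\<^sub>R w) (h *\<^sub>R w))) (at t)"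
        by (rule has_derivative_compose[where g = \<phi> and f = "\<lambda>t. u + t *\<^sub>R w", OF _ d(1)[OF inU[OF that]]])
          (auto intro!: derivative_eq_intros)
      then show ?thesis by (simp add: has_vector_derivative_def blinfun.scaleR_right)
    qed
    have "continuous_on {-e<..<e} (\<lambda>t. \<phi>' (u + t *\<^sub>R w) w)"
      by (intro continuous_intros continuous_on_compose2[OF cont]) (use inU in auto)
    then have "(\<lambda>t. \<phi> (u + t *\<^sub>R w)) C1_differentiable_on {-e<..<e}"
      unfolding C1_differentiable_on_def
      by (intro exI[of _ "\<lambda>t. \<phi>' (u + t *\<^sub>R w) w"] conjI ballI d)
    moreover have "(\<lambda>t. \<phi> (u + t *\<^sub>R w)) ` {-e<..<e} \<subseteq> S" using inU img by blast
    moreover have "((\<lambda>t. \<phi> (u + t *\<^sub>R w)) has_vector_derivative v) (at 0)"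
      using d[of 0] e w by simp
    ultimately show "v \<in> tangent_space S (\<phi> u)"
      unfolding tangent_space_def using e(1)
      by (intro CollectI exI[of _ e] conjI exI[of _ "\<lambda>t. \<phi> (u + t *\<^sub>R w)"]) auto
  qed
  have sub2: "tangent_space S (\<phi> u) \<subseteq> {v. N (\<phi> u) \<bullet> v = 0}" if u: "u \<in> U" for u
    using N img[OF u] by (auto simp: unit_normal_field_def)
  have eq: "range (\<phi>' u) = {v. N (\<phi> u) \<bullet> v = 0}" if u: "u \<in> U" for u
  proof (rule subspace_dim_equal)
    have lin: "linear (blinfun_apply (\<phi>' u))"
      by (simp add: blinfun.bounded_linear_right bounded_linear.linear)
    show "subspace (range (\<phi>' u))" using lin by (simp add: linear_subspace_image)
    show "subspace {v. N (\<phi> u) \<bullet> v = 0}" by (rule subspace_hyperplane)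
    show "range (\<phi>' u) \<subseteq> {v. N (\<phi> u) \<bullet> v = 0}" using sub sub2 u by blast
    have "dim (range (\<phi>' u)) = 2"
      using dim_image_eq[OF lin, of UNIV] inj[OF u] by (simp add: dim_UNIV)
    moreover have "N (\<phi> u) \<noteq> 0" using N img[OF u] by (force simp: unit_normal_field_def)
    ultimately show "dim {v. N (\<phi> u) \<bullet> v = 0} \<le> dim (range (\<phi>' u))"
      by (simp add: dim_hyperplane)
  qed
  show thesis
  proof (rule that)
    show "surface_chart S N U V \<phi> \<psi> \<phi>' \<phi>''"
      by unfold_locales (use c(1,2,4) N d inj eq sub sub2 in \<open>force+\<close>)
    show "p \<in> V" by fact
  qed
qed

lemma tangent_space_eq_normal_complement:
  assumes "C2_surface S" "unit_normal_field S N" "p \<in> S"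
  shows "tangent_space S p = {v. N p \<bullet> v = 0}"
proof -
  obtain U V \<phi> \<psi> \<phi>' \<phi>'' where c: "surface_chart S N U V \<phi> \<psi> \<phi>' \<phi>''" and p: "p \<in> V"
    using surface_chart_exists[OF assms] .
  interpret surface_chart S N U V \<phi> \<psi> \<phi>' \<phi>'' by (rule c)
  show ?thesis
    using tangent_space_chart[of "\<psi> p"] inverse_chart[OF \<open>p \<in> S\<close> p] by simp
qed

context surface_chart
begin

text \<open>Up to a sign, the normal is the normalized cross product of the coordinate vectors.
  These are differentiable because the chart is twice differentiable, and the sign is locally
  constant because the normal field is continuous.\<close>

lemma normal_chart_differentiable:
  assumes "u \<in> U"
  shows "(\<lambda>u. N (\<phi> u)) differentiable (at u)"
proof -
  define m where "m u = cross3 (\<phi>' u (axis 1 1)) (\<phi>' u (axis 2 1))" for u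
  have m0: "m x \<noteq> 0" if "x \<in> U" for x
  proof
    assume "m x = 0"
    let ?a = "\<phi>' x (axis 1 1)" and ?b = "\<phi>' x (axis 2 1)"
    have "collinear {0, ?a, ?b}" using \<open>m x = 0\<close> by (simp add: m_def cross_eq_0)
    then consider "?a = 0" | "?b = 0" | k where "?b = k *\<^sub>R ?a"
      unfolding collinear_lemma by blast
    then show False
    proof cases
      case 1
      then have "axis 1 1 = (0::real^2)" using immersion[OF that] by (metis blinfun.zero_right injD)
      then show False by (simp add: axis_eq_0_iff)
    next
      case 2
      then have "axis 2 1 = (0::real^2)" using immersion[OF that] by (metis blinfun.zero_right injD)
      then show False by (simp add: axis_eq_0_iff)
    next
      case 3
      then have "\<phi>' x (axis 2 1) = \<phi>' x (k *\<^sub>R axis 1 1)" by (simp add: blinfun.scaleR_right)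
      then have "axis 2 1 = k *\<^sub>R (axis 1 1 :: real^2)" using immersion[OF that] injD by metis
      then have "(axis 2 1 :: real^2) $ 2 = (k *\<^sub>R axis 1 1 :: real^2) $ 2" by simp
      then show False by (simp add: axis_def)
    qed
  qed
  have Nm: "(m x \<bullet> m x) *\<^sub>R N (\<phi> x) = (N (\<phi> x) \<bullet> m x) *\<^sub>R m x" if "x \<in> U" for x
  proof -
    show ?thesis unfolding m_def
      by (intro parallel_if_orthogonal_to_both normal_orthogonal_deriv that)
  qed
  have sq: "(N (\<phi> x) \<bullet> m x)\<^sup>2 = (norm (m x))\<^sup>2" if "x \<in> U" for x
  proof -
    have "norm ((m x \<bullet> m x) *\<^sub>R N (\<phi> x)) = norm ((N (\<phi> x) \<bullet> m x) *\<^sub>R m x)"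
      using Nm[OF that] by simp
    then have "(norm (m x))\<^sup>2 = \<bar>N (\<phi> x) \<bullet> m x\<bar> * norm (m x)"
      using norm_normal[OF that] by (simp add: power2_norm_eq_inner)
    then have "norm (m x) = \<bar>N (\<phi> x) \<bullet> m x\<bar>" using m0[OF that] by (simp add: power2_eq_square)
    then show ?thesis by (metis power2_abs)
  qed
  define s where "s = sgn (N (\<phi> u) \<bullet> m u)"
  have s0: "s * (N (\<phi> u) \<bullet> m u) > 0"
    using sq[OF \<open>u \<in> U\<close>] m0[OF \<open>u \<in> U\<close>] by (auto simp: s_def sgn_real_def)
  have ev: "\<forall>\<^sub>F x in at u. s * (N (\<phi> x) \<bullet> m x) > 0"
  proof -
    have "continuous_on U (\<lambda>x. s * (N (\<phi> x) \<bullet> m x))"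
      unfolding m_def using normal chart_in_surface
      by (intro continuous_intros continuous_on_cross continuous_deriv
          continuous_on_compose2[OF _ continuous_chart])
        (auto simp: unit_normal_field_def)
    then have "isCont (\<lambda>x. s * (N (\<phi> x) \<bullet> m x)) u"
      using open_dom \<open>u \<in> U\<close> continuous_on_eq_continuous_at by blast
    then show ?thesis using s0 unfolding isCont_def by (rule order_tendstoD(1))
  qed
  have eq: "N (\<phi> x) = (s / norm (m x)) *\<^sub>R m x"
    if "x \<in> U" "s * (N (\<phi> x) \<bullet> m x) > 0" for x
  proof -
    have ss: "\<bar>s\<bar> = 1" using s0 by (auto simp: s_def sgn_real_def split: if_splits)
    have "\<bar>N (\<phi> x) \<bullet> m x\<bar> = norm (m x)"
      using sq[OF that(1)] by (metis abs_norm_cancel power2_eq_iff_nonneg abs_ge_zero power2_abs)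
    moreover have "N (\<phi> x) \<bullet> m x = s * \<bar>N (\<phi> x) \<bullet> m x\<bar>"
    proof (cases "s = 1")
      case False
      then have "s = -1" using ss by (auto simp: abs_if split: if_splits)
      then show ?thesis using that(2) by auto
    qed (use that(2) in auto)
    ultimately have "N (\<phi> x) \<bullet> m x = s * norm (m x)" by simp
    then have "((norm (m x))\<^sup>2) *\<^sub>R N (\<phi> x) = (s * norm (m x)) *\<^sub>R m x"
      using Nm[OF that(1)] by (simp add: power2_norm_eq_inner)
    then have "inverse ((norm (m x))\<^sup>2) *\<^sub>R ((norm (m x))\<^sup>2) *\<^sub>R N (\<phi> x) = inverse ((norm (m x))\<^sup>2) *\<^sub>R (s * norm (m x)) *\<^sub>R m x"
      by simp
    moreover have "inverse ((norm (m x))\<^sup>2) * (norm (m x))\<^sup>2 = 1"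
      "inverse ((norm (m x))\<^sup>2) * (s * norm (m x)) = s / norm (m x)"
      using m0[OF that(1)] by (simp, simp add: power2_eq_square divide_inverse)
    ultimately show ?thesis by (simp only: scaleR_scaleR scaleR_one)
  qed
  have "(\<lambda>x. (s / norm (m x)) *\<^sub>R m x) differentiable (at u)"
  proof -
    have D1: "(\<lambda>x. \<phi>' x w) differentiable (at u)" for w
      unfolding differentiable_def
      by (rule exI, rule bounded_linear.has_derivative[OF blinfun.bounded_linear_left deriv2[OF assms]])
    have D2: "m differentiable (at u)"
      using D1[of "axis 1 1"] D1[of "axis 2 1"] unfolding m_def differentiable_def
      by (elim exE) (rule exI, rule cross3_derivative)
    moreover have "norm differentiable (at (m u))"
      by (rule differentiable_norm_at[OF m0[OF \<open>u \<in> U\<close>]])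
    ultimately have D3: "(\<lambda>x. norm (m x)) differentiable (at u)"
      by (simp add: differentiable_compose)
    show ?thesis
      by (intro differentiable_scaleR differentiable_divide D2 D3) (use m0[OF \<open>u \<in> U\<close>] in auto)
  qed
  moreover have "\<forall>\<^sub>F x in at u. (s / norm (m x)) *\<^sub>R m x = N (\<phi> x)"
    using ev eventually_at_in_open'[OF open_dom \<open>u \<in> U\<close>]
    by eventually_elim (use eq in auto)
  moreover have "(s / norm (m u)) *\<^sub>R m u = N (\<phi> u)" using eq[OF \<open>u \<in> U\<close> s0] by simp
  ultimately show ?thesis
    unfolding differentiable_def by (elim exE) (rule exI, erule has_derivative_transform_eventually, auto)
qed

end

section \<open>The derivative of the normal field\<close>

text \<open>Near a point the surface is a graph over its tangent plane, in the following coordinate-free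
  form: a linear map \<open>L\<close> is left inverse to the parametrization \<open>G\<close>.  For \<open>L\<close> one takes
  a left inverse of the derivative of the chart at the point, so that \<open>L \<circ> \<phi>\<close> has the identity
  as derivative there and the inverse function theorem applies to it.\<close>

lemma (in surface_chart) graph_chart:
  assumes p: "p \<in> S" "p \<in> V"
  obtains L :: "real^3 \<Rightarrow> real^2" and W V' G
  where "bounded_linear L" "open W" "open V'" "p \<in> V'"
    "\<forall>q\<in>S \<inter> V'. L q \<in> W \<and> G (L q) = q"
    "\<forall>y\<in>W. G y \<in> S \<and> L (G y) = y"
    "\<forall>y\<in>W. \<exists>G'. (G has_derivative G') (at y) \<and> (\<forall>w. N (G y) \<bullet> G' w = 0)"
    "\<forall>y\<in>W. (\<lambda>y. N (G y)) differentiable (at y)"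
proof -
  define u0 where "u0 = \<psi> p"
  have u0: "u0 \<in> U" "\<phi> u0 = p" using inverse_chart p by (auto simp: u0_def)
  have "linear (\<phi>' u0)" by (simp add: blinfun.bounded_linear_right bounded_linear.linear)
  then obtain L0 where L0: "linear L0" "L0 \<circ> \<phi>' u0 = id"
    using linear_injective_left_inverse[OF _ immersion[OF u0(1)]] by blast
  define L where "L = Blinfun L0"
  have L: "L (\<phi>' u0 w) = w" for w
    using L0 by (auto simp: L_def bounded_linear_Blinfun_apply linear_conv_bounded_linear dest: fun_cong)
  have der: "((\<lambda>u. L (\<phi> u)) has_derivative (L o\<^sub>L \<phi>' u)) (at u)" if "u \<in> U" for u
    using bounded_linear.has_derivative[OF blinfun.bounded_linear_right deriv[OF that], of L]
    by (simp add: blinfun_compose.rep_eq o_def)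
  have cont: "continuous_on U (\<lambda>u. L o\<^sub>L \<phi>' u)"
    by (intro continuous_intros continuous_deriv)
  have inv: "id_blinfun o\<^sub>L (L o\<^sub>L \<phi>' u0) = id_blinfun"
    by (rule blinfun_eqI) (simp add: L)
  obtain U' W g g' where g: "open U'" "U' \<subseteq> U" "u0 \<in> U'" "open W"
    "homeomorphism U' W (\<lambda>u. L (\<phi> u)) g" "\<And>y. y \<in> W \<Longrightarrow> (g has_derivative (g' y)) (at y)"
    using inverse_function_theorem[OF open_dom der cont u0(1) inv] by metis
  have "openin (top_of_set (S \<inter> V)) (\<phi> ` U')"
    using homeomorphism_imp_open_map[OF homeo, of U'] g(1,2) by (simp add: open_subset)
  then obtain V1 where V1: "open V1" "\<phi> ` U' = S \<inter> V \<inter> V1" by (auto simp: openin_open)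
  have gU: "g y \<in> U'" "g y \<in> U" "L (\<phi> (g y)) = y" if "y \<in> W" for y
    using g(2,5) that by (auto simp: homeomorphism_def)
  show thesis
  proof (rule that[where L = L and W = W and V' = "V \<inter> V1" and G = "\<lambda>y. \<phi> (g y)"])
    show "bounded_linear L" by (rule blinfun.bounded_linear_right)
    show "open W" "open (V \<inter> V1)" using g V1 open_cod by auto
    show "p \<in> V \<inter> V1" using V1 u0 g by blast
    show "\<forall>q\<in>S \<inter> (V \<inter> V1). L q \<in> W \<and> \<phi> (g (L q)) = q"
    proof
      fix q assume q: "q \<in> S \<inter> (V \<inter> V1)"
      obtain u where "u \<in> U'" "q = \<phi> u" using V1 q by blast
      then show "L q \<in> W \<and> \<phi> (g (L q)) = q" using g(5) by (auto simp: homeomorphism_def)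
    qed
    show "\<forall>y\<in>W. \<phi> (g y) \<in> S \<and> L (\<phi> (g y)) = y"
      using chart_in_surface gU by blast
    have gd: "g differentiable (at y)" if "y \<in> W" for y
      using g(6)[OF that] by (auto simp: differentiable_def)
    show "\<forall>y\<in>W. \<exists>G'. ((\<lambda>y. \<phi> (g y)) has_derivative G') (at y) \<and> (\<forall>w. N (\<phi> (g y)) \<bullet> G' w = 0)"
    proof
      fix y assume y: "y \<in> W"
      have "((\<lambda>y. \<phi> (g y)) has_derivative (\<lambda>w. \<phi>' (g y) (g' y w))) (at y)"
        by (rule has_derivative_compose[OF g(6)[OF y] deriv[OF gU(2)[OF y]]])
      then show "\<exists>G'. ((\<lambda>y. \<phi> (g y)) has_derivative G') (at y) \<and> (\<forall>w. N (\<phi> (g y)) \<bullet> G' w = 0)"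
        using normal_orthogonal_deriv[OF gU(2)[OF y]] by blast
    qed
    show "\<forall>y\<in>W. (\<lambda>y. N (\<phi> (g y))) differentiable (at y)"
      by (intro ballI differentiable_compose[OF normal_chart_differentiable[OF gU(2)] gd])
  qed
qed

text \<open>Near \<open>p\<close> the normal field on \<open>S\<close> agrees with \<open>N \<circ> G \<circ> L\<close>, which is defined
  and differentiable on an open set of the ambient space.\<close>

lemma normal_field_differentiable:
  assumes "C2_surface S" "unit_normal_field S N" "p \<in> S"
  shows "N differentiable (at p within S)"
proof -
  obtain U V \<phi> \<psi> \<phi>' \<phi>'' where c: "surface_chart S N U V \<phi> \<psi> \<phi>' \<phi>''" and p: "p \<in> V"
    using surface_chart_exists[OF assms] .
  interpret surface_chart S N U V \<phi> \<psi> \<phi>' \<phi>'' by (rule c)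
  obtain L :: "real^3 \<Rightarrow> real^2" and W V' G
    where G: "bounded_linear L" "open W" "open V'" "p \<in> V'"
      "\<forall>q\<in>S \<inter> V'. L q \<in> W \<and> G (L q) = q"
      "\<forall>y\<in>W. G y \<in> S \<and> L (G y) = y"
      "\<forall>y\<in>W. \<exists>G'. (G has_derivative G') (at y) \<and> (\<forall>w. N (G y) \<bullet> G' w = 0)"
      "\<forall>y\<in>W. (\<lambda>y. N (G y)) differentiable (at y)"
    using graph_chart[OF \<open>p \<in> S\<close> p] .
  have "L p \<in> W" using G \<open>p \<in> S\<close> by blast
  have "(\<lambda>q. N (G (L q))) differentiable (at p)"
    by (rule differentiable_compose[where f = "\<lambda>y. N (G y)" and g = L, OF bspec[OF G(8) \<open>L p \<in> W\<close>]])
      (use G(1) in \<open>simp add: bounded_linear_imp_differentiable\<close>)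
  then have "(\<lambda>q. N (G (L q))) differentiable (at p within S)"
    by (rule differentiable_at_withinI)
  then obtain D where D: "((\<lambda>q. N (G (L q))) has_derivative D) (at p within S)"
    by (auto simp: differentiable_def)
  have "(N has_derivative D) (at p within S)"
  proof (rule has_derivative_transform_eventually[OF D])
    show "\<forall>\<^sub>F q in at p within S. N (G (L q)) = N q"
      unfolding eventually_at_topological using G by (intro exI[of _ V']) auto
  qed (use G \<open>p \<in> S\<close> in auto)
  then show ?thesis by (auto simp: differentiable_def)
qed

text \<open>Differentiating \<open>N \<bullet> N = 1\<close> shows that the derivative is tangential; differentiating
  \<open>N \<bullet> \<phi>' k = 0\<close> in the direction \<open>h\<close> expresses \<open>D (\<phi>' h) \<bullet> \<phi>' k\<close> as
  \<open>- N \<bullet> \<phi>'' h k\<close>, which is symmetric in \<open>h\<close> and \<open>k\<close>.\<close>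

lemma normal_derivative_tangential_self_adjoint:
  assumes S: "C2_surface S" "unit_normal_field S N" "p \<in> S"
    and D: "(N has_derivative D) (at p within S)"
    and v: "v \<in> tangent_space S p" and w: "w \<in> tangent_space S p"
  shows "D v \<in> tangent_space S p" and "D v \<bullet> w = v \<bullet> D w"
proof -
  obtain U V \<phi> \<psi> \<phi>' \<phi>'' where c: "surface_chart S N U V \<phi> \<psi> \<phi>' \<phi>''" and p: "p \<in> V"
    using surface_chart_exists[OF S] .
  interpret surface_chart S N U V \<phi> \<psi> \<phi>' \<phi>'' by (rule c)
  define u where "u = \<psi> p"
  have u: "u \<in> U" "\<phi> u = p" using inverse_chart p \<open>p \<in> S\<close> by (auto simp: u_def)
  have T: "tangent_space S p = {v. N p \<bullet> v = 0}"
    using tangent_space_eq_normal_complement[OF S] .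
  obtain a b where ab: "v = \<phi>' u a" "w = \<phi>' u b"
    using v w range_deriv[OF u(1)] u(2) T by force
  have ND: "((\<lambda>x. N (\<phi> x)) has_derivative (\<lambda>h. D (\<phi>' u h))) (at u)"
  proof -
    have "(N has_derivative D) (at (\<phi> u) within \<phi> ` U)"
      using D u chart_in_surface by (auto intro: has_derivative_subset)
    then have "((\<lambda>x. N (\<phi> x)) has_derivative (\<lambda>h. D (\<phi>' u h))) (at u within U)"
      using has_derivative_in_compose[of \<phi> "\<phi>' u" u U N D] deriv[OF u(1)] has_derivative_at_withinI by blast
    then show ?thesis using at_within_open[OF u(1) open_dom] by simp
  qed
  have zero: "F h = 0"
    if "((\<lambda>x. f x) has_derivative F) (at u)" "\<And>x. x \<in> U \<Longrightarrow> f x = c" for f :: "real^2 \<Rightarrow> real" and F c h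
  proof -
    have "((\<lambda>x. c) has_derivative F) (at u)"
      by (rule has_derivative_transform_within_open[OF that(1) open_dom u(1) that(2)])
    then have "F = (\<lambda>h. 0)" using has_derivative_unique has_derivative_const by blast
    then show ?thesis by simp
  qed
  have "((\<lambda>x. N (\<phi> x) \<bullet> N (\<phi> x)) has_derivative (\<lambda>h. N (\<phi> u) \<bullet> D (\<phi>' u h) + D (\<phi>' u h) \<bullet> N (\<phi> u))) (at u)"
    by (rule has_derivative_inner[OF ND ND])
  from zero[OF this, of 1 a] have "N p \<bullet> D v = 0"
    using norm_normal by (auto simp: u ab inner_commute norm_eq_1)
  then show "D v \<in> tangent_space S p" using T by simp
  have *: "D (\<phi>' u h) \<bullet> \<phi>' u k = - (N p \<bullet> \<phi>'' u h k)" for h k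
  proof -
    have "((\<lambda>x. \<phi>' x k) has_derivative (\<lambda>h. \<phi>'' u h k)) (at u)"
      by (rule bounded_linear.has_derivative[OF blinfun.bounded_linear_left deriv2[OF u(1)]])
    then have "((\<lambda>x. N (\<phi> x) \<bullet> \<phi>' x k) has_derivative (\<lambda>h. N (\<phi> u) \<bullet> \<phi>'' u h k + D (\<phi>' u h) \<bullet> \<phi>' u k)) (at u)"
      by (rule has_derivative_inner[OF ND])
    from zero[OF this, of 0 h] show ?thesis using normal_orthogonal_deriv by (simp add: u)
  qed
  show "D v \<bullet> w = v \<bullet> D w"
    using *[of a b] *[of b a]
      symmetric_second_derivative[OF open_dom u(1) deriv deriv2 continuous_deriv2, of a b]
    by (simp add: ab inner_commute)
qed

section \<open>Compact umbilic surfaces are spheres\<close>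

text \<open>In the graph chart put \<open>H = L \<circ> N \<circ> G\<close>.  Since \<open>L\<close> inverts the derivative of
  \<open>G\<close>, umbilicity says that the derivative of \<open>H\<close> is \<open>\<mu>\<close> times the identity, so
  \<open>\<mu>\<close> is constant near the point.  Once \<open>\<mu>\<close> is constant, \<open>N - \<mu> q\<close> has
  zero derivative along the surface and is constant as well.\<close>

lemma umbilic_locally_spherical:
  fixes \<mu> :: "real^3 \<Rightarrow> real"
  assumes S: "C2_surface S" "unit_normal_field S N"
    and umb: "\<And>q v D. q \<in> S \<Longrightarrow> v \<in> tangent_space S q \<Longrightarrow> (N has_derivative D) (at q within S) \<Longrightarrow> D v = \<mu> q *\<^sub>R v"
    and p: "p \<in> S"
  shows "\<exists>T. openin (top_of_set S) T \<and> p \<in> T \<and>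
    (\<forall>q\<in>T. (\<mu> q, N q - \<mu> q *\<^sub>R q) = (\<mu> p, N p - \<mu> p *\<^sub>R p))"
proof -
  obtain U V \<phi> \<psi> \<phi>' \<phi>'' where c: "surface_chart S N U V \<phi> \<psi> \<phi>' \<phi>''" and pV: "p \<in> V"
    using surface_chart_exists[OF S p] .
  interpret surface_chart S N U V \<phi> \<psi> \<phi>' \<phi>'' by (rule c)
  obtain L :: "real^3 \<Rightarrow> real^2" and W V' G
    where G: "bounded_linear L" "open W" "open V'" "p \<in> V'"
      "\<forall>q\<in>S \<inter> V'. L q \<in> W \<and> G (L q) = q"
      "\<forall>y\<in>W. G y \<in> S \<and> L (G y) = y"
      "\<forall>y\<in>W. \<exists>G'. (G has_derivative G') (at y) \<and> (\<forall>w. N (G y) \<bullet> G' w = 0)"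
      "\<forall>y\<in>W. (\<lambda>y. N (G y)) differentiable (at y)"
    using graph_chart[OF p pV] .
  have "L p \<in> W" using G p by blast
  then obtain a b where box: "box a b \<subseteq> W" "L p \<in> box a b"
    using open_contains_box[OF \<open>open W\<close>] by metis
  have key: "\<exists>G'. (G has_derivative G') (at y) \<and> ((\<lambda>y. N (G y)) has_derivative (\<lambda>w. \<mu> (G y) *\<^sub>R G' w)) (at y)
      \<and> (\<forall>w. L (G' w) = w)" if y: "y \<in> W" for y
  proof -
    obtain G' where G': "(G has_derivative G') (at y)" "\<forall>w. N (G y) \<bullet> G' w = 0"
      using G(7) y by blast
    have yS: "G y \<in> S" using G y by blast
    obtain D where D: "(N has_derivative D) (at (G y) within S)"
      using normal_field_differentiable[OF S yS] by (auto simp: differentiable_def)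
    have "(G has_derivative G') (at y within W)" using G'(1) by (rule has_derivative_at_withinI)
    moreover have "(N has_derivative D) (at (G y) within G ` W)"
      by (rule has_derivative_subset[OF D]) (use G in auto)
    ultimately have "((\<lambda>y. N (G y)) has_derivative (\<lambda>w. D (G' w))) (at y within W)"
      by (rule has_derivative_in_compose)
    then have "((\<lambda>y. N (G y)) has_derivative (\<lambda>w. D (G' w))) (at y)"
      using at_within_open[OF y \<open>open W\<close>] by simp
    moreover have "D (G' w) = \<mu> (G y) *\<^sub>R G' w" for w
      using umb[OF yS _ D] tangent_space_eq_normal_complement[OF S yS] G'(2) by simp
    moreover have "L (G' w) = w" for w
    proof -
      have "((\<lambda>y. L (G y)) has_derivative (\<lambda>w. L (G' w))) (at y)"
        by (rule bounded_linear.has_derivative[OF G(1) G'(1)])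
      moreover have "((\<lambda>y. L (G y)) has_derivative (\<lambda>w. w)) (at y)"
        by (rule has_derivative_transform_within_open[OF has_derivative_ident \<open>open W\<close> y])
          (use G in auto)
      ultimately show ?thesis using has_derivative_unique by (metis (no_types))
    qed
    ultimately show ?thesis using G'(1) by auto
  qed
  have conf: "((\<lambda>y. L (N (G y))) has_derivative (\<lambda>w. \<mu> (G y) *\<^sub>R w)) (at y)" if y: "y \<in> box a b" for y
  proof -
    obtain G' where "((\<lambda>y. N (G y)) has_derivative (\<lambda>w. \<mu> (G y) *\<^sub>R G' w)) (at y)" "\<forall>w. L (G' w) = w"
      using key y box by blast
    then show ?thesis
      using bounded_linear.has_derivative[OF G(1), of "\<lambda>y. N (G y)" "\<lambda>w. \<mu> (G y) *\<^sub>R G' w" "at y"]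
      by (simp add: linear_simps G(1) linear_scale bounded_linear.linear)
  qed
  have mu: "\<mu> (G y) = \<mu> p" if "y \<in> box a b" for y
    using conformal_factor_constant[of a b "\<lambda>y. L (N (G y))" "\<lambda>y. \<mu> (G y)", OF conf that box(2)]
      G(4,5) p by simp
  have const: "N (G y) - \<mu> p *\<^sub>R G y = N p - \<mu> p *\<^sub>R p" if y: "y \<in> box a b" for y
  proof -
    have "((\<lambda>y. N (G y) - \<mu> p *\<^sub>R G y) has_derivative (\<lambda>w. 0)) (at z within box a b)" if z: "z \<in> box a b" for z
    proof -
      obtain G' where "(G has_derivative G') (at z)" "((\<lambda>y. N (G y)) has_derivative (\<lambda>w. \<mu> (G z) *\<^sub>R G' w)) (at z)"
        using key z box by blast
      then have "((\<lambda>y. N (G y) - \<mu> p *\<^sub>R G y) has_derivative (\<lambda>w. \<mu> (G z) *\<^sub>R G' w - \<mu> p *\<^sub>R G' w)) (at z)"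
        by (intro has_derivative_diff has_derivative_scaleR_right)
      then show ?thesis using mu[OF z] by (auto intro: has_derivative_at_withinI)
    qed
    from has_derivative_zero_unique[OF convex_box(2) this y box(2)]
    show ?thesis using G(4,5) p by simp
  qed
  have "open (V' \<inter> L -` box a b)"
    using G(1,3) by (intro open_Int continuous_open_vimage) (auto simp: linear_continuous_at)
  then have "openin (top_of_set S) (S \<inter> (V' \<inter> L -` box a b))"
    by (rule openin_open_Int)
  moreover have "(\<mu> q, N q - \<mu> q *\<^sub>R q) = (\<mu> p, N p - \<mu> p *\<^sub>R p)" if "q \<in> S \<inter> (V' \<inter> L -` box a b)" for q
    using mu[of "L q"] const[of "L q"] G(5) that by auto
  ultimately show ?thesis using p G(4) box(2) by (intro exI[of _ "S \<inter> (V' \<inter> L -` box a b)"] conjI ballI) blast+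
qed

lemma critical_point_of_height:
  assumes "\<And>q. q \<in> S \<Longrightarrow> q \<bullet> z \<le> p \<bullet> z" and v: "v \<in> tangent_space S p"
  shows "v \<bullet> z = 0"
proof -
  obtain e c where c: "e > 0" "c ` {-e<..<e} \<subseteq> S" "c 0 = p" "(c has_vector_derivative v) (at (0::real))"
    using v by (auto simp: tangent_space_def)
  have "((\<lambda>t. c t \<bullet> z) has_derivative (\<lambda>h. (h *\<^sub>R v) \<bullet> z)) (at 0)"
    using c(4) unfolding has_vector_derivative_def by (rule has_derivative_inner_left)
  then have "((\<lambda>t. c t \<bullet> z) has_real_derivative v \<bullet> z) (at 0)"
    by (simp add: has_field_derivative_def mult_commute_abs)
  moreover have "\<forall>t. \<bar>0 - t\<bar> < e \<longrightarrow> c t \<bullet> z \<le> c 0 \<bullet> z"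
  proof (intro allI impI)
    fix t assume "\<bar>0 - t\<bar> < e"
    then have "t \<in> {-e<..<e}" by auto
    then show "c t \<bullet> z \<le> c 0 \<bullet> z" using assms(1) c(2,3) by blast
  qed
  ultimately show ?thesis using DERIV_local_max c(1) by blast
qed

lemma parallel_if_same_hyperplane:
  fixes n x :: "'a::real_inner"
  assumes "norm n = 1" "\<And>v. n \<bullet> v = 0 \<Longrightarrow> v \<bullet> x = 0"
  shows "x = (n \<bullet> x) *\<^sub>R n"
proof -
  have nn: "n \<bullet> n = 1" using assms(1) by (simp add: norm_eq_1)
  let ?v = "x - (n \<bullet> x) *\<^sub>R n"
  have n: "n \<bullet> ?v = 0" by (simp add: inner_diff_right nn)
  have "?v \<bullet> ?v = ?v \<bullet> x - (n \<bullet> x) * (n \<bullet> ?v)"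
    by (simp only: inner_diff_right inner_scaleR_right inner_commute[of ?v n])
  then have "?v \<bullet> ?v = 0" using assms(2)[OF n] n by simp
  then show ?thesis by simp
qed

text \<open>By connectedness \<open>N q = m q + a\<close> on all of \<open>S\<close>.  If \<open>m\<close> were zero, \<open>S\<close> would
  have constant normal \<open>a\<close>; but at the highest point of \<open>S\<close> in a direction \<open>w\<close> the
  tangent plane is orthogonal to \<open>w\<close>, which fails for \<open>w\<close> orthogonal to \<open>a\<close>.  So
  \<open>S\<close> lies in the sphere about \<open>c = - a / m\<close> of radius \<open>1 / \<bar>m\<bar>\<close>.  That it fills
  the sphere follows from the same principle: for \<open>z\<close> on the sphere, the highest
  point of \<open>S\<close> in the direction \<open>z - c\<close> is \<open>z\<close> or its antipode.\<close>

lemma compact_umbilic_surface_is_sphere: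
  fixes \<mu> :: "real^3 \<Rightarrow> real"
  assumes S: "C2_surface S" "unit_normal_field S N" and "S \<noteq> {}" "compact S" "connected S"
    and umb: "\<And>q v D. q \<in> S \<Longrightarrow> v \<in> tangent_space S q \<Longrightarrow> (N has_derivative D) (at q within S) \<Longrightarrow> D v = \<mu> q *\<^sub>R v"
  shows "\<exists>c R. R > 0 \<and> S = sphere c R"
proof -
  have T: "tangent_space S q = {v. N q \<bullet> v = 0}" if "q \<in> S" for q
    by (rule tangent_space_eq_normal_complement[OF S that])
  have N1: "norm (N q) = 1" if "q \<in> S" for q using S(2) that by (simp add: unit_normal_field_def)
  have "(\<lambda>q. (\<mu> q, N q - \<mu> q *\<^sub>R q)) constant_on S"
    by (rule locally_constant_imp_constant[OF \<open>connected S\<close>])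
      (rule umbilic_locally_spherical[OF S], rule umb)
  then obtain x where "\<forall>q\<in>S. (\<mu> q, N q - \<mu> q *\<^sub>R q) = x"
    unfolding constant_on_def by blast
  moreover obtain m a where "x = (m, a)" by fastforce
  ultimately have ma: "\<mu> q = m" "N q - \<mu> q *\<^sub>R q = a" if "q \<in> S" for q
    using that by auto
  have Nq: "N q = m *\<^sub>R q + a" if "q \<in> S" for q
    using ma(1)[OF that] ma(2)[OF that] by (simp add: algebra_simps)
  have maximizer: "\<exists>p\<in>S. \<forall>q\<in>S. q \<bullet> z \<le> p \<bullet> z" for z
    by (rule continuous_attains_sup[OF \<open>compact S\<close> \<open>S \<noteq> {}\<close>]) (intro continuous_intros)
  have "m \<noteq> 0"
  proof
    assume "m = 0"
    obtain w where w: "w \<noteq> 0" "orthogonal a w" using orthogonal_to_vector_exists[of a] by auto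
    obtain p where p: "p \<in> S" "\<forall>q\<in>S. q \<bullet> w \<le> p \<bullet> w" using maximizer by blast
    have "w \<in> tangent_space S p" using T[OF p(1)] Nq[OF p(1)] \<open>m = 0\<close> w by (simp add: orthogonal_def)
    then have "w \<bullet> w = 0" using critical_point_of_height p by blast
    then show False using w by simp
  qed
  define c where "c = - (1 / m) *\<^sub>R a"
  define R where "R = 1 / \<bar>m\<bar>"
  have "R > 0" using \<open>m \<noteq> 0\<close> by (simp add: R_def)
  have Nc: "N q = m *\<^sub>R (q - c)" if "q \<in> S" for q
    using Nq[OF that] \<open>m \<noteq> 0\<close> by (simp add: c_def algebra_simps)
  have dist: "norm (q - c) = R" if "q \<in> S" for q
  proof -
    have "norm (N q) = \<bar>m\<bar> * norm (q - c)" unfolding Nc[OF that] by (rule norm_scaleR)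
    then show ?thesis using N1[OF that] \<open>m \<noteq> 0\<close> by (simp add: R_def field_simps)
  qed
  have "S = sphere c R"
  proof
    show "S \<subseteq> sphere c R" using dist by (auto simp: dist_norm norm_minus_commute)
    show "sphere c R \<subseteq> S"
    proof
      fix z assume "z \<in> sphere c R"
      then have z: "norm (z - c) = R" by (simp add: dist_norm norm_minus_commute)
      obtain p where p: "p \<in> S" "\<forall>q\<in>S. q \<bullet> (z - c) \<le> p \<bullet> (z - c)" using maximizer by blast
      have "z - c = (N p \<bullet> (z - c)) *\<^sub>R N p"
        by (rule parallel_if_same_hyperplane[OF N1[OF p(1)]])
          (use critical_point_of_height p T[OF p(1)] in blast)
      then obtain k where k: "z - c = k *\<^sub>R (p - c)" using Nc[OF p(1)] by auto
      have "\<bar>k\<bar> = 1" using z dist[OF p(1)] \<open>R > 0\<close> unfolding k by simp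
      then consider "k = 1" | "k = -1" by linarith
      then show "z \<in> S"
      proof cases
        case 1
        then show ?thesis using k p(1) by simp
      next
        case 2
        \<comment> \<open>The highest point of \<open>S\<close> is the lowest point of the sphere, so \<open>S\<close> would be a single point and have no nonzero tangent vector.\<close>
        have "q = p" if "q \<in> S" for q
        proof -
          have "(p - c) \<bullet> (p - c) \<le> (q - c) \<bullet> (p - c)"
            using p(2) that unfolding k 2 by (auto simp: inner_diff_left inner_diff_right inner_commute)
          moreover have "(p - c) \<bullet> (p - c) = R\<^sup>2" "(q - c) \<bullet> (q - c) = R\<^sup>2"
            using dist[OF p(1)] dist[OF that] by (simp_all add: power2_norm_eq_inner[symmetric])
          ultimately have "(q - p) \<bullet> (q - p) \<le> 0"
            by (simp add: inner_diff_left inner_diff_right inner_commute)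
          then show ?thesis using inner_ge_zero[of "q - p"] by (simp add: order.antisym)
        qed
        moreover obtain w where w: "w \<noteq> 0" "orthogonal (N p) w"
          using orthogonal_to_vector_exists[of "N p"] by auto
        moreover then have "w \<in> tangent_space S p" using T[OF p(1)] by (simp add: orthogonal_def)
        ultimately have "w \<bullet> w = 0" using critical_point_of_height[of S w p w] by auto
        then show ?thesis using w by simp
      qed
    qed
  qed
  then show ?thesis using \<open>R > 0\<close> by blast
qed

section \<open>Isotropic linear maps\<close>

text \<open>A self-adjoint map that scales all lengths by \<open>\<sigma>\<close> has square \<open>\<sigma>\<^sup>2\<close>, so
  \<open>M v - \<sigma> v\<close> is an eigenvector for \<open>- \<sigma>\<close> unless it vanishes; positivity of the
  eigenvalues leaves only the second possibility.  Without positivity a reflection would be a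
  counterexample.\<close>

lemma self_adjoint_homothety_positive_is_scalar:
  fixes M :: "'a::real_inner \<Rightarrow> 'a"
  assumes lin: "linear M" and T: "subspace T" and inv: "\<And>v. v \<in> T \<Longrightarrow> M v \<in> T"
    and self: "\<And>v w. v \<in> T \<Longrightarrow> w \<in> T \<Longrightarrow> M v \<bullet> w = v \<bullet> M w"
    and homothety: "\<And>v. v \<in> T \<Longrightarrow> norm v = 1 \<Longrightarrow> norm (M v) = \<sigma>"
    and pos: "\<And>v k. v \<in> T \<Longrightarrow> v \<noteq> 0 \<Longrightarrow> M v = k *\<^sub>R v \<Longrightarrow> 0 < k"
    and v: "v \<in> T"
  shows "M v = \<sigma> *\<^sub>R v"
proof (cases "v = 0")
  case True
  then show ?thesis using lin by (simp add: linear_0)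
next
  case False
  have norm: "norm (M x) = \<sigma> * norm x" if "x \<in> T" for x
  proof (cases "x = 0")
    case True
    then show ?thesis using lin by (simp add: linear_0)
  next
    case False
    have "norm (M ((1 / norm x) *\<^sub>R x)) = \<sigma>"
      using False that T by (intro homothety) (auto simp: subspace_scale)
    then show ?thesis using False by (simp add: linear_scale[OF lin] field_simps)
  qed
  have sq: "M x \<bullet> M x = \<sigma>\<^sup>2 * (x \<bullet> x)" if "x \<in> T" for x
    using norm[OF that] by (simp add: power2_norm_eq_inner[symmetric] power_mult_distrib)
  have inner: "M x \<bullet> M y = \<sigma>\<^sup>2 * (x \<bullet> y)" if "x \<in> T" "y \<in> T" for x y
    using sq[of "x + y"] sq[of x] sq[of y] that T
    by (simp add: subspace_add linear_add[OF lin] inner_add_left inner_add_right inner_commute algebra_simps)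
  have square: "M (M x) = \<sigma>\<^sup>2 *\<^sub>R x" if "x \<in> T" for x
  proof -
    define y where "y = M (M x) - \<sigma>\<^sup>2 *\<^sub>R x"
    have y: "y \<in> T" using that inv T by (simp add: y_def subspace_diff subspace_scale)
    have "y \<bullet> y = M (M x) \<bullet> y - \<sigma>\<^sup>2 * (x \<bullet> y)" by (simp add: y_def inner_diff_left)
    also have "\<dots> = 0" using self[OF inv[OF that] y] inner[OF that y] by simp
    finally show ?thesis by (simp add: y_def)
  qed
  define w where "w = M v - \<sigma> *\<^sub>R v"
  have w: "w \<in> T" using v inv T by (simp add: w_def subspace_diff subspace_scale)
  have "M w = (- \<sigma>) *\<^sub>R w"
    using square[OF v] by (simp add: w_def linear_diff[OF lin] linear_scale[OF lin] algebra_simps power2_eq_square)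
  moreover have "\<sigma> \<ge> 0" using norm[OF v] False by (metis norm_ge_zero zero_le_mult_iff zero_less_norm_iff not_less)
  ultimately have "w = 0" using pos[OF w, of "- \<sigma>"] by linarith
  then show ?thesis by (simp add: w_def)
qed

section \<open>Spheres and rigid motions\<close>

lemma tangent_space_sphere:
  assumes "R > 0" "norm (q - c) = R"
  shows "tangent_space (sphere c R) q = {v. (q - c) \<bullet> v = 0}"
proof (intro equalityI subsetI CollectI)
  fix v assume "v \<in> tangent_space (sphere c R) q"
  then obtain e \<alpha> where \<alpha>: "e > 0" "\<alpha> ` {-e<..<e} \<subseteq> sphere c R" "\<alpha> 0 = q" "(\<alpha> has_vector_derivative v) (at (0::real))"
    by (auto simp: tangent_space_def)
  have d: "((\<lambda>t. (\<alpha> t - c) \<bullet> (\<alpha> t - c)) has_derivative (\<lambda>h. (q - c) \<bullet> (h *\<^sub>R v) + (h *\<^sub>R v) \<bullet> (q - c))) (at 0)"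
    using \<alpha>(3,4) unfolding has_vector_derivative_def by (auto intro!: derivative_eq_intros)
  have "((\<lambda>t. R\<^sup>2) has_derivative (\<lambda>h. (q - c) \<bullet> (h *\<^sub>R v) + (h *\<^sub>R v) \<bullet> (q - c))) (at 0)"
  proof (rule has_derivative_transform_within_open[OF d, of "{-e<..<e}"])
    fix t assume "t \<in> {-e<..<e}"
    then have "\<alpha> t \<in> sphere c R" using \<alpha>(2) by blast
    then have "norm (\<alpha> t - c) = R" by (simp add: dist_norm norm_minus_commute)
    then show "(\<alpha> t - c) \<bullet> (\<alpha> t - c) = R\<^sup>2" by (simp add: power2_norm_eq_inner[symmetric])
  qed (use \<alpha>(1) in auto)
  then have "(\<lambda>h. (q - c) \<bullet> (h *\<^sub>R v) + (h *\<^sub>R v) \<bullet> (q - c)) = (\<lambda>h::real. 0)"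
    using has_derivative_unique has_derivative_const by blast
  from fun_cong[OF this, of 1] show "(q - c) \<bullet> v = 0" by (simp add: inner_commute)
next
  fix v assume "v \<in> {v. (q - c) \<bullet> v = 0}"
  then have v: "(q - c) \<bullet> v = 0" by simp
  define k where "k = norm v / R"
  \<comment> \<open>The great circle through \<open>q\<close> with velocity \<open>v\<close>; the case \<open>v = 0\<close>, where the frequency \<open>k\<close> vanishes, is a constant curve.\<close>
  define \<alpha> where "\<alpha> t = c + cos (k * t) *\<^sub>R (q - c) + (if v = 0 then 0 else (sin (k * t) / k) *\<^sub>R v)" for t
  define \<alpha>' where "\<alpha>' t = (- k * sin (k * t)) *\<^sub>R (q - c) + cos (k * t) *\<^sub>R v" for t
  have k: "k \<noteq> 0" if "v \<noteq> 0" using that assms(1) by (simp add: k_def)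
  have d: "(\<alpha> has_vector_derivative \<alpha>' t) (at t)" for t
    using k unfolding \<alpha>_def \<alpha>'_def by (cases "v = 0") (auto intro!: derivative_eq_intros simp: k_def)
  have on: "\<alpha> t \<in> sphere c R" for t
  proof -
    have "(norm (\<alpha> t - c))\<^sup>2 = R\<^sup>2"
    proof (cases "v = 0")
      case True
      then show ?thesis using assms(2) by (simp add: \<alpha>_def k_def)
    next
      case False
      have "(norm (\<alpha> t - c))\<^sup>2 = (cos (k * t))\<^sup>2 * (norm (q - c))\<^sup>2 + (sin (k * t))\<^sup>2 * ((norm v)\<^sup>2 / k\<^sup>2)"
        using v False norm_add_Pythagorean[of "cos (k * t) *\<^sub>R (q - c)" "(sin (k * t) / k) *\<^sub>R v"]
        by (simp add: \<alpha>_def orthogonal_def power_mult_distrib power_divide add_diff_eq[symmetric])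
      also have "(norm v)\<^sup>2 / k\<^sup>2 = R\<^sup>2" using False assms(1) by (simp add: k_def power_divide)
      finally show ?thesis using assms(2) by (simp add: distrib_right[symmetric])
    qed
    then have "norm (\<alpha> t - c) = R" using assms(1) by (simp add: power2_eq_iff_nonneg)
    then show ?thesis by (simp add: dist_norm norm_minus_commute)
  qed
  have "\<alpha> C1_differentiable_on {-1<..<1}"
    unfolding C1_differentiable_on_def
    by (intro exI[of _ \<alpha>'] conjI ballI d) (auto simp: \<alpha>'_def intro!: continuous_intros)
  moreover have "\<alpha> 0 = q" by (simp add: \<alpha>_def)
  moreover have "(\<alpha> has_vector_derivative v) (at 0)" using d[of 0] by (simp add: \<alpha>'_def)
  ultimately show "v \<in> tangent_space (sphere c R) q"
    unfolding tangent_space_def using on by (intro CollectI exI[of _ 1] conjI exI[of _ \<alpha>]) auto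
qed

lemma bounded_linear_matrix_vector_mult_left: "bounded_linear (\<lambda>A :: real^'n^'m. A *v x)"
  by (simp add: linear_conv_bounded_linear[symmetric] linear_iff matrix_vector_mult_add_rdistrib
      scaleR_matrix_vector_assoc)

lemma rotation_matrix_norm:
  assumes "rotation_matrix A"
  shows "norm (A *v x) = norm (x :: real^3)"
  using assms orthogonal_transformation_matrix[of "(*v) A"]
  by (simp add: rotation_matrix_def orthogonal_transformation matrix_of_matrix_vector_mul)

lemma affine_motion_sphere:
  assumes "rotation_matrix (A t)"
  shows "affine_motion A b t ` sphere c R = sphere (affine_motion A b t c) R"
proof -
  have d: "dist (affine_motion A b t x) (affine_motion A b t y) = dist x y" for x y
    using rotation_matrix_norm[OF assms, of "x - y"]
    by (simp add: affine_motion_def dist_norm matrix_vector_mult_diff_distrib)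
  have orth: "A t ** transpose (A t) = mat 1"
    using assms by (simp add: rotation_matrix_def orthogonal_matrix_def)
  have inv: "affine_motion A b t (transpose (A t) *v (y - b t)) = y" for y
    unfolding affine_motion_def matrix_vector_mul_assoc orth by simp
  show ?thesis
  proof (intro equalityI subsetI)
    fix y assume "y \<in> sphere (affine_motion A b t c) R"
    then have "transpose (A t) *v (y - b t) \<in> sphere c R" using inv[of y] d by (metis mem_sphere)
    then show "y \<in> affine_motion A b t ` sphere c R" using inv[of y] by (metis imageI)
  qed (auto simp: d)
qed

section \<open>The path of the center\<close>

lemma C1_upto_imp_continuous: "C1_upto l f \<Longrightarrow> continuous_on {0..l} f"
  unfolding C1_upto_def by (metis continuous_on_vector_derivative)

text \<open>Surfaces that are tangent at a point share the normal line there, so the moved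
  center is \<open>\<gamma> t \<plusminus> r N (\<gamma> t)\<close>.  The sign cannot jump, and it is positive at time
  \<open>0\<close>.\<close>

lemma center_of_sphere_moved_along:
  assumes S: "C2_surface S" "unit_normal_field S N" and "r \<noteq> 0"
    and \<gamma>: "continuous_on {0..e} \<gamma>" "\<gamma> ` {0..e} \<subseteq> S" and "0 < e"
    and mot: "motion_along (sphere (ball_center N r (\<gamma> 0)) \<bar>r\<bar>) S e \<gamma> A b" and t: "t \<in> {0..e}"
  shows "affine_motion A b t (ball_center N r (\<gamma> 0)) = ball_center N r (\<gamma> t)"
proof -
  define c where "c = ball_center N r (\<gamma> 0)"
  define g where "g t = affine_motion A b t c" for t
  note mot = mot[folded c_def]
  have gt: "\<exists>k\<in>{r, -r}. g t - \<gamma> t = k *\<^sub>R N (\<gamma> t)" if "t \<in> {0..e}" for t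
  proof -
    have rot: "rotation_matrix (A t)" and tan: "tangent_at (affine_motion A b t ` sphere c \<bar>r\<bar>) S (\<gamma> t)"
      using mot that by (auto simp: motion_along_def)
    have "tangent_at (sphere (g t) \<bar>r\<bar>) S (\<gamma> t)"
      using tan by (simp add: affine_motion_sphere[where A = A and t = t, OF rot] g_def)
    then have q: "norm (\<gamma> t - g t) = \<bar>r\<bar>" "\<gamma> t \<in> S" "tangent_space (sphere (g t) \<bar>r\<bar>) (\<gamma> t) = tangent_space S (\<gamma> t)"
      by (auto simp: tangent_at_def dist_norm norm_minus_commute)
    have N1: "norm (N (\<gamma> t)) = 1" using S(2) q(2) by (simp add: unit_normal_field_def)
    have "{v. (\<gamma> t - g t) \<bullet> v = 0} = {v. N (\<gamma> t) \<bullet> v = 0}"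
      using q(3) tangent_space_eq_normal_complement[OF S q(2)] tangent_space_sphere[OF _ q(1)] \<open>r \<noteq> 0\<close> by simp
    then have perp: "\<And>v. N (\<gamma> t) \<bullet> v = 0 \<Longrightarrow> v \<bullet> (\<gamma> t - g t) = 0" by (auto simp: inner_commute)
    obtain k where k: "\<gamma> t - g t = k *\<^sub>R N (\<gamma> t)"
      using parallel_if_same_hyperplane[OF N1 perp] by blast
    have "\<bar>k\<bar> = \<bar>r\<bar>" using q(1) N1 by (simp add: k)
    then have "- k \<in> {r, -r}" by auto
    moreover have "g t - \<gamma> t = (- k) *\<^sub>R N (\<gamma> t)" using k by (simp add: algebra_simps)
    ultimately show ?thesis by blast
  qed
  define h where "h t = (g t - \<gamma> t) \<bullet> N (\<gamma> t)" for t
  have nn: "N (\<gamma> t) \<bullet> N (\<gamma> t) = 1" if "t \<in> {0..e}" for t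
  proof -
    have "\<gamma> t \<in> S" using \<gamma>(2) that by blast
    then show ?thesis using S(2) by (simp add: unit_normal_field_def norm_eq_1[symmetric])
  qed
  have gh: "g t - \<gamma> t = h t *\<^sub>R N (\<gamma> t) \<and> h t \<in> {r, -r}" if "t \<in> {0..e}" for t
    using gt[OF that] nn[OF that] by (auto simp: h_def)
  have "continuous_on {0..e} A" "continuous_on {0..e} b"
    using mot C1_upto_imp_continuous by (auto simp: motion_along_def)
  then have contg: "continuous_on {0..e} g"
    unfolding g_def affine_motion_def
    by (intro continuous_intros bounded_linear.continuous_on[OF bounded_linear_matrix_vector_mult_left])
  have "continuous_on {0..e} h"
    unfolding h_def
    by (intro continuous_intros contg \<gamma>(1) continuous_on_compose2[OF _ \<gamma>(1)])
      (use S(2) \<gamma>(2) in \<open>auto simp: unit_normal_field_def\<close>)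
  moreover have "finite (h ` {0..e})"
    by (rule finite_subset[of _ "{r, -r}"]) (use gh in blast, simp)
  ultimately have "h constant_on {0..e}" by (intro continuous_finite_range_constant) auto
  moreover have "h 0 = r"
  proof -
    have "g 0 = c" using mot by (simp add: motion_along_def g_def)
    then show ?thesis using nn[of 0] \<open>0 < e\<close> by (simp add: h_def c_def ball_center_def)
  qed
  ultimately have "h t = r" using t \<open>0 < e\<close> unfolding constant_on_def by fastforce
  then show ?thesis using gh[OF t] by (simp add: g_def c_def ball_center_def algebra_simps)
qed

section \<open>Curves of unit speed\<close>

text \<open>\<open>\<tau>\<close> is the inverse of the arc length measured from parameter \<open>0\<close>.  Working on a
  two-sided interval around \<open>0\<close> makes \<open>\<tau>\<close> differentiable at \<open>0\<close> in the
  two-sided sense.\<close>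

lemma arclength_reparametrization:
  fixes \<alpha>' :: "real \<Rightarrow> 'a::euclidean_space"
  assumes "d > 0" and cont: "continuous_on {-d..d} \<alpha>'" and ne: "\<And>t. t \<in> {-d..d} \<Longrightarrow> \<alpha>' t \<noteq> 0"
  obtains l \<tau> where "l > 0" "\<tau> 0 = 0"
    "\<forall>s\<in>{0..l}. \<tau> s \<in> {-d<..<d} \<and> (\<tau> has_real_derivative inverse (norm (\<alpha>' (\<tau> s)))) (at s)"
proof -
  have "continuous_on {-d..d} (\<lambda>t. norm (\<alpha>' t))" by (intro continuous_intros cont)
  then obtain \<sigma>0 where \<sigma>0: "\<And>t. t \<in> {-d..d} \<Longrightarrow> (\<sigma>0 has_vector_derivative norm (\<alpha>' t)) (at t within {-d..d})"
    using antiderivative_continuous by blast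
  define \<sigma> where "\<sigma> t = \<sigma>0 t - \<sigma>0 0" for t
  have \<sigma>: "(\<sigma> has_real_derivative norm (\<alpha>' t)) (at t)" if "t \<in> {-d<..<d}" for t
  proof -
    have "(\<sigma>0 has_real_derivative norm (\<alpha>' t)) (at t within {-d<..<d})"
      unfolding has_real_derivative_iff_has_vector_derivative
      by (rule has_vector_derivative_within_subset[OF \<sigma>0]) (use that in auto)
    then have "(\<sigma>0 has_real_derivative norm (\<alpha>' t)) (at t)"
      using at_within_open[OF that] by simp
    then show ?thesis unfolding \<sigma>_def by (auto intro!: derivative_eq_intros)
  qed
  have mono: "\<sigma> x < \<sigma> y" if "x < y" "x \<in> {-d<..<d}" "y \<in> {-d<..<d}" for x y
  proof (rule DERIV_pos_imp_increasing[OF \<open>x < y\<close>])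
    fix t assume "x \<le> t" "t \<le> y"
    then have "t \<in> {-d<..<d}" using that by auto
    then show "\<exists>D. (\<sigma> has_real_derivative D) (at t) \<and> D > 0" using \<sigma>[of t] ne[of t] by fastforce
  qed
  then have inj: "inj_on \<sigma> {-d<..<d}"
    by (intro linorder_inj_onI') (metis less_irrefl)
  define \<tau> where "\<tau> = inv_into {-d<..<d} \<sigma>"
  have \<tau>\<sigma>: "\<tau> (\<sigma> t) = t" if "t \<in> {-d<..<d}" for t
    unfolding \<tau>_def using inv_into_f_f[OF inj that] .
  have cont\<sigma>: "continuous_on {-d<..<d} \<sigma>"
    by (intro continuous_at_imp_continuous_on ballI) (use \<sigma> DERIV_isCont in blast)
  have \<tau>: "(\<tau> has_real_derivative inverse (norm (\<alpha>' t))) (at (\<sigma> t))" if "t \<in> {-d<..<d}" for t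
    unfolding has_field_derivative_def
  proof (rule has_derivative_inverse_strong[OF _ that cont\<sigma> \<tau>\<sigma>])
    show "(\<sigma> has_derivative (*) (norm (\<alpha>' t))) (at t)"
      using \<sigma>[OF that] by (simp add: has_field_derivative_def)
    show "(*) (norm (\<alpha>' t)) \<circ> (*) (inverse (norm (\<alpha>' t))) = id"
      using ne[of t] that by (auto simp: fun_eq_iff)
  qed auto
  have \<sigma>00: "\<sigma> 0 = 0" by (simp add: \<sigma>_def)
  show thesis
  proof (rule that[of "\<sigma> (d / 2)" \<tau>])
    show "\<sigma> (d / 2) > 0" using mono[of 0 "d / 2"] \<sigma>00 \<open>d > 0\<close> by simp
    show "\<tau> 0 = 0" using \<tau>\<sigma>[of 0] \<sigma>00 \<open>d > 0\<close> by simp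
    show "\<forall>s\<in>{0..\<sigma> (d / 2)}. \<tau> s \<in> {-d<..<d} \<and> (\<tau> has_real_derivative inverse (norm (\<alpha>' (\<tau> s)))) (at s)"
    proof
      fix s assume s: "s \<in> {0..\<sigma> (d / 2)}"
      have "\<exists>t\<ge>0. t \<le> d / 2 \<and> \<sigma> t = s"
        by (rule IVT') (use s \<sigma>00 \<open>d > 0\<close> in \<open>auto intro: continuous_on_subset[OF cont\<sigma>]\<close>)
      then obtain t where "0 \<le> t" "t \<le> d / 2" "\<sigma> t = s" by blast
      moreover then have "t \<in> {-d<..<d}" using \<open>d > 0\<close> by auto
      ultimately show "\<tau> s \<in> {-d<..<d} \<and> (\<tau> has_real_derivative inverse (norm (\<alpha>' (\<tau> s)))) (at s)"
        using \<tau>[of t] \<tau>\<sigma>[of t] by auto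
    qed
  qed
qed

text \<open>The chart image of a straight line, parametrized by arc length.  Isotropic rolling constrains
  only directions for which such a curve exists, so this is what makes the hypothesis
  of isotropy effective.\<close>

lemma unit_speed_curve_exists:
  assumes S: "C2_surface S" "unit_normal_field S N" and p: "p \<in> S"
    and v: "v \<in> tangent_space S p" "norm v = 1"
  obtains l \<gamma> where "unit_speed_curve S l \<gamma>" "\<gamma> 0 = p" "(\<gamma> has_vector_derivative v) (at 0 within {0..l})"
proof -
  obtain U V \<phi> \<psi> \<phi>' \<phi>'' where c: "surface_chart S N U V \<phi> \<psi> \<phi>' \<phi>''" and pV: "p \<in> V"
    using surface_chart_exists[OF S p] .
  interpret surface_chart S N U V \<phi> \<psi> \<phi>' \<phi>'' by (rule c)
  define u where "u = \<psi> p"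
  have u: "u \<in> U" "\<phi> u = p" using inverse_chart p pV by (auto simp: u_def)
  obtain w where w: "v = \<phi>' u w"
    using v range_deriv[OF u(1)] u(2) tangent_space_eq_normal_complement[OF S p] by force
  have "w \<noteq> 0" using v(2) w by (auto simp: blinfun.zero_right)
  \<comment> \<open>A closed interval of parameters: arc length is to be defined by integration over it.\<close>
  have "open ((\<lambda>t::real. u + t *\<^sub>R w) -` U)"
    by (intro continuous_open_vimage open_dom continuous_intros)
  then obtain e where e: "e > 0" "cball 0 e \<subseteq> (\<lambda>t::real. u + t *\<^sub>R w) -` U"
    using u(1) by (metis (no_types, lifting) add.right_neutral open_contains_cball scale_zero_left vimageI)
  have inU: "u + t *\<^sub>R w \<in> U" if "t \<in> {-e..e}" for t
    using e that by (auto simp: subset_iff dist_real_def)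
  define \<alpha> where "\<alpha> t = \<phi> (u + t *\<^sub>R w)" for t
  define \<alpha>' where "\<alpha>' t = \<phi>' (u + t *\<^sub>R w) w" for t
  define \<alpha>'' where "\<alpha>'' t = \<phi>'' (u + t *\<^sub>R w) w w" for t
  have \<alpha>: "(\<alpha> has_vector_derivative \<alpha>' t) (at t)" if "t \<in> {-e..e}" for t
  proof -
    have "((\<lambda>t. \<phi> (u + t *\<^sub>R w)) has_derivative (\<lambda>h. \<phi>' (u + t *\<^sub>R w) (h *\<^sub>R w))) (at t)"
      by (rule has_derivative_compose[where g = \<phi> and f = "\<lambda>t. u + t *\<^sub>R w", OF _ deriv[OF inU[OF that]]])
        (auto intro!: derivative_eq_intros)
    then show ?thesis by (simp add: has_vector_derivative_def blinfun.scaleR_right \<alpha>_def[abs_def] \<alpha>'_def)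
  qed
  have \<alpha>': "(\<alpha>' has_vector_derivative \<alpha>'' t) (at t)" if "t \<in> {-e..e}" for t
  proof -
    have "((\<lambda>t. \<phi>' (u + t *\<^sub>R w)) has_derivative (\<lambda>h. \<phi>'' (u + t *\<^sub>R w) (h *\<^sub>R w))) (at t)"
      by (rule has_derivative_compose[where g = \<phi>' and f = "\<lambda>t. u + t *\<^sub>R w", OF _ deriv2[OF inU[OF that]]])
        (auto intro!: derivative_eq_intros)
    from bounded_linear.has_derivative[OF blinfun.bounded_linear_left this, of w]
    show ?thesis
      by (simp add: has_vector_derivative_def blinfun.scaleR_right blinfun.scaleR_left \<alpha>'_def[abs_def] \<alpha>''_def)
  qed
  have cont\<alpha>': "continuous_on {-e..e} \<alpha>'"
    by (intro continuous_at_imp_continuous_on ballI has_vector_derivative_continuous[OF \<alpha>'])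
  have cont\<alpha>'': "continuous_on {-e..e} \<alpha>''"
    unfolding \<alpha>''_def by (intro continuous_intros continuous_on_compose2[OF continuous_deriv2]) (use inU in auto)
  have ne: "\<alpha>' t \<noteq> 0" if "t \<in> {-e..e}" for t
    using immersion[OF inU[OF that]] \<open>w \<noteq> 0\<close> unfolding \<alpha>'_def by (metis blinfun.zero_right injD)
  obtain l \<tau> where l: "l > 0" and \<tau>0: "\<tau> 0 = 0"
    and \<tau>: "\<forall>s\<in>{0..l}. \<tau> s \<in> {-e<..<e} \<and> (\<tau> has_real_derivative inverse (norm (\<alpha>' (\<tau> s)))) (at s)"
    using arclength_reparametrization[OF e(1) cont\<alpha>' ne] .
  define \<nu> where "\<nu> t = inverse (norm (\<alpha>' t))" for t
  define \<nu>' where "\<nu>' t = - (\<nu> t * (\<alpha>'' t \<bullet> sgn (\<alpha>' t)) * \<nu> t)" for t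
  have \<nu>: "(\<nu> has_real_derivative \<nu>' t) (at t)" if "t \<in> {-e..e}" for t
  proof -
    have "((\<lambda>t. norm (\<alpha>' t)) has_derivative (\<lambda>h. (h *\<^sub>R \<alpha>'' t) \<bullet> sgn (\<alpha>' t))) (at t)"
      by (rule has_derivative_compose[where g = norm and f = \<alpha>', OF _ has_derivative_norm[OF ne[OF that]]])
        (use \<alpha>'[OF that] in \<open>simp add: has_vector_derivative_def\<close>)
    then have "((\<lambda>t. norm (\<alpha>' t)) has_real_derivative (\<alpha>'' t \<bullet> sgn (\<alpha>' t))) (at t)"
      by (simp add: has_field_derivative_def mult_commute_abs)
    from DERIV_inverse'[OF this] show ?thesis
      using ne[OF that] by (simp add: \<nu>_def[abs_def] \<nu>'_def)
  qed
  define \<gamma> where "\<gamma> s = \<alpha> (\<tau> s)" for s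
  define \<gamma>' where "\<gamma>' s = \<nu> (\<tau> s) *\<^sub>R \<alpha>' (\<tau> s)" for s
  define \<gamma>'' where "\<gamma>'' s = \<nu> (\<tau> s) *\<^sub>R (\<nu> (\<tau> s) *\<^sub>R \<alpha>'' (\<tau> s) + \<nu>' (\<tau> s) *\<^sub>R \<alpha>' (\<tau> s))" for s
  have \<tau>e: "\<tau> s \<in> {-e..e}" if "s \<in> {0..l}" for s using \<tau> that by fastforce
  have \<tau>d: "(\<tau> has_vector_derivative \<nu> (\<tau> s)) (at s)" if "s \<in> {0..l}" for s
    using \<tau> that by (simp add: has_real_derivative_iff_has_vector_derivative \<nu>_def)
  have \<gamma>: "(\<gamma> has_vector_derivative \<gamma>' s) (at s)" if "s \<in> {0..l}" for s
    using vector_diff_chain_at[OF \<tau>d[OF that] \<alpha>[OF \<tau>e[OF that]]]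
    by (simp add: \<gamma>_def[abs_def] \<gamma>'_def o_def)
  have \<gamma>': "(\<gamma>' has_vector_derivative \<gamma>'' s) (at s)" if "s \<in> {0..l}" for s
    using vector_diff_chain_at[OF \<tau>d[OF that]
        has_vector_derivative_scaleR[OF \<nu>[OF \<tau>e[OF that]] \<alpha>'[OF \<tau>e[OF that]]]]
    by (simp add: \<gamma>'_def[abs_def] \<gamma>''_def o_def)
  have norm\<gamma>': "norm (\<gamma>' s) = 1" if "s \<in> {0..l}" for s
    using ne[OF \<tau>e[OF that]] by (simp add: \<gamma>'_def \<nu>_def)
  have cont\<tau>: "continuous_on {0..l} \<tau>"
    by (intro continuous_at_imp_continuous_on ballI has_vector_derivative_continuous[OF \<tau>d])
  have cont\<nu>: "continuous_on {-e..e} \<nu>"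
    unfolding \<nu>_def using ne by (intro continuous_intros cont\<alpha>') auto
  have cont\<nu>': "continuous_on {-e..e} \<nu>'"
    unfolding \<nu>'_def sgn_div_norm using ne by (intro continuous_intros cont\<alpha>' cont\<alpha>'' cont\<nu>) auto
  have "\<tau> ` {0..l} \<subseteq> {-e..e}" using \<tau>e by blast
  note comp = continuous_on_compose2[OF _ cont\<tau> this]
  have cont\<gamma>'': "continuous_on {0..l} \<gamma>''"
    unfolding \<gamma>''_def
    by (intro continuous_intros comp[OF cont\<nu>] comp[OF cont\<nu>'] comp[OF cont\<alpha>'] comp[OF cont\<alpha>''])
  have in_S: "\<gamma> ` {0..l} \<subseteq> S"
    using chart_in_surface inU \<tau>e by (auto simp: \<gamma>_def \<alpha>_def)
  have "unit_speed_curve S l \<gamma>"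
    unfolding unit_speed_curve_def using l in_S norm\<gamma>' cont\<gamma>'' \<gamma> \<gamma>'
    by (intro conjI exI[of _ \<gamma>'] exI[of _ \<gamma>'']) (auto intro: has_vector_derivative_at_within)
  moreover have "\<gamma> 0 = p" by (simp add: \<gamma>_def \<alpha>_def \<tau>0 u)
  moreover have "\<gamma>' 0 = v" using v(2) by (simp add: \<gamma>'_def \<nu>_def \<alpha>'_def \<tau>0 w[symmetric])
  then have "(\<gamma> has_vector_derivative v) (at 0 within {0..l})"
    using \<gamma>[of 0] l by (auto intro: has_vector_derivative_at_within)
  ultimately show thesis by (rule that)
qed

lemma unit_speed_curveD:
  assumes "unit_speed_curve S l \<gamma>"
  obtains \<gamma>' where "0 < l" "\<gamma> ` {0..l} \<subseteq> S" "continuous_on {0..l} \<gamma>" "continuous_on {0..l} \<gamma>'"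
    "\<forall>t\<in>{0..l}. (\<gamma> has_vector_derivative \<gamma>' t) (at t within {0..l}) \<and> norm (\<gamma>' t) = 1"
proof -
  obtain \<gamma>' \<gamma>'' where g: "\<forall>t\<in>{0..l}. (\<gamma> has_vector_derivative \<gamma>' t) (at t within {0..l}) \<and>
      (\<gamma>' has_vector_derivative \<gamma>'' t) (at t within {0..l}) \<and> norm (\<gamma>' t) = 1"
    and "0 < l" "\<gamma> ` {0..l} \<subseteq> S"
    using assms unfolding unit_speed_curve_def by blast
  moreover have "continuous_on {0..l} \<gamma>" "continuous_on {0..l} \<gamma>'"
    using g by (auto intro!: continuous_on_vector_derivative)
  ultimately show thesis using that by blast
qed

section \<open>Isotropic rolling forces umbilic points\<close>

text \<open>The center moves along \<open>\<gamma> + r N \<circ> \<gamma>\<close>, whose initial velocity is \<open>v + r D v\<close>; in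
  terms of the shape operator \<open>A = - D\<close> this is \<open>(I - r A) v\<close>.\<close>

lemma rolling_ball_speed:
  assumes S: "C2_surface S" "unit_normal_field S N" and "r \<noteq> 0"
    and D: "(N has_derivative D) (at p within S)"
    and \<gamma>: "unit_speed_curve S l \<gamma>" "\<gamma> 0 = p" "(\<gamma> has_vector_derivative v) (at 0 within {0..l})"
    and e: "0 < e" "e \<le> l" and roll: "ball_rolls S N r e \<gamma> A b"
  shows "ball_speed e A b (ball_center N r p) 0 = norm (v + r *\<^sub>R D v)"
proof -
  obtain \<gamma>' where g: "0 < l" "\<gamma> ` {0..l} \<subseteq> S" "continuous_on {0..l} \<gamma>" "continuous_on {0..l} \<gamma>'"
    "\<forall>t\<in>{0..l}. (\<gamma> has_vector_derivative \<gamma>' t) (at t within {0..l}) \<and> norm (\<gamma>' t) = 1"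
    using unit_speed_curveD[OF \<gamma>(1)] .
  have sub: "{0..e} \<subseteq> {0..l}" using e by auto
  have c: "affine_motion A b t (ball_center N r p) = \<gamma> t + r *\<^sub>R N (\<gamma> t)" if "t \<in> {0..e}" for t
  proof -
    have "\<gamma> ` {0..e} \<subseteq> S" using g(2) sub by blast
    moreover have "motion_along (sphere (ball_center N r (\<gamma> 0)) \<bar>r\<bar>) S e \<gamma> A b"
      using roll by (simp add: ball_rolls_def rolling_def rotational_motion_def)
    ultimately have "affine_motion A b t (ball_center N r (\<gamma> 0)) = ball_center N r (\<gamma> t)"
      using center_of_sphere_moved_along[OF S \<open>r \<noteq> 0\<close> continuous_on_subset[OF g(3) sub] _ e(1) _ that]
      by blast
    then show ?thesis by (simp add: ball_center_def \<gamma>(2))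
  qed
  have v: "(\<gamma> has_derivative (\<lambda>h. h *\<^sub>R v)) (at 0 within {0..e})"
    using has_vector_derivative_within_subset[OF \<gamma>(3) sub] by (simp add: has_vector_derivative_def)
  have "(N has_derivative D) (at (\<gamma> 0) within \<gamma> ` {0..e})"
    by (rule has_derivative_subset[of _ _ _ S]) (use D \<gamma>(2) g(2) sub in auto)
  from has_derivative_in_compose[OF v this]
  have "((\<lambda>t. N (\<gamma> t)) has_vector_derivative D v) (at 0 within {0..e})"
    using has_derivative_bounded_linear[OF D] by (simp add: has_vector_derivative_def linear_simps)
  then have "((\<lambda>t. \<gamma> t + r *\<^sub>R N (\<gamma> t)) has_vector_derivative v + r *\<^sub>R D v) (at 0 within {0..e})"
    using v by (intro has_vector_derivative_add bounded_linear.has_vector_derivative[OF bounded_linear_scaleR_right])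
      (simp_all add: has_vector_derivative_def)
  then have d: "((\<lambda>t. affine_motion A b t (ball_center N r p)) has_vector_derivative v + r *\<^sub>R D v) (at 0 within {0..e})"
    by (rule has_vector_derivative_transform[rotated 2]) (use e c in auto)
  show ?thesis
    unfolding ball_speed_def using vector_derivative_within_closed_interval[OF e(1) _ d] e by simp
qed

text \<open>\<open>M = I + r D\<close> is self-adjoint on the tangent plane and scales all lengths by the common
  speed \<open>\<sigma>\<close>.  If \<open>M x = k x\<close>, then \<open>(1 - k) / r\<close> is a principal curvature, so the
  curvature bound says \<open>\<bar>1 - k\<bar> < 1\<close>, and \<open>k\<close> is positive.  Hence \<open>M = \<sigma> I\<close>.\<close>

lemma isotropic_imp_umbilic:
  assumes S: "C2_surface S" "unit_normal_field S N" and p: "p \<in> S" and "r \<noteq> 0"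
    and curv: "\<forall>k\<in>principal_curvatures S N p. \<bar>k\<bar> < 1 / \<bar>r\<bar>"
    and iso: "rolls_isotropically S N r p"
  shows "\<exists>\<mu>. \<forall>v\<in>tangent_space S p. \<forall>D. (N has_derivative D) (at p within S) \<longrightarrow> D v = \<mu> *\<^sub>R v"
proof -
  obtain D where D: "(N has_derivative D) (at p within S)"
    using normal_field_differentiable[OF S p] by (auto simp: differentiable_def)
  have linD: "linear D" using has_derivative_linear[OF D] .
  obtain \<sigma> where \<sigma>: "\<forall>v\<in>tangent_space S p. norm v = 1 \<longrightarrow>
      (\<forall>l \<gamma>. unit_speed_curve S l \<gamma> \<and> \<gamma> 0 = p \<and> (\<gamma> has_vector_derivative v) (at 0 within {0..l}) \<longrightarrow>
        (\<exists>e A b. 0 < e \<and> e \<le> l \<and> ball_rolls S N r e \<gamma> A b \<and> ball_speed e A b (ball_center N r p) 0 = \<sigma>))"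
    using iso unfolding rolls_isotropically_def ..
  have T: "tangent_space S p = {v. N p \<bullet> v = 0}" by (rule tangent_space_eq_normal_complement[OF S p])
  have speed: "norm (v + r *\<^sub>R D v) = \<sigma>" if v: "v \<in> tangent_space S p" "norm v = 1" for v
  proof -
    obtain l \<gamma> where g: "unit_speed_curve S l \<gamma>" "\<gamma> 0 = p" "(\<gamma> has_vector_derivative v) (at 0 within {0..l})"
      using unit_speed_curve_exists[OF S p v] .
    obtain e A b where "0 < e" "e \<le> l" "ball_rolls S N r e \<gamma> A b" "ball_speed e A b (ball_center N r p) 0 = \<sigma>"
      using \<sigma>[rule_format, OF v conjI[OF g(1) conjI[OF g(2,3)]]] by (elim exE conjE)
    then show ?thesis using rolling_ball_speed[OF S \<open>r \<noteq> 0\<close> D g] by simp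
  qed
  have scalar: "v + r *\<^sub>R D v = \<sigma> *\<^sub>R v" if v: "v \<in> tangent_space S p" for v
  proof (rule self_adjoint_homothety_positive_is_scalar[where T = "tangent_space S p" and M = "\<lambda>v. v + r *\<^sub>R D v"])
    show "linear (\<lambda>v. v + r *\<^sub>R D v)"
      by (intro linearI) (simp_all add: linear_add[OF linD] linear_scale[OF linD] algebra_simps)
    show sub: "subspace (tangent_space S p)" unfolding T by (rule subspace_hyperplane)
    fix x assume x: "x \<in> tangent_space S p"
    show "x + r *\<^sub>R D x \<in> tangent_space S p"
      using normal_derivative_tangential_self_adjoint(1)[OF S p D x x] sub x
      by (simp add: subspace_add subspace_scale)
    show "(x + r *\<^sub>R D x) \<bullet> y = x \<bullet> (y + r *\<^sub>R D y)" if y: "y \<in> tangent_space S p" for y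
      using normal_derivative_tangential_self_adjoint(2)[OF S p D x y]
      by (simp add: inner_add_left inner_add_right)
    show "norm (x + r *\<^sub>R D x) = \<sigma>" if "norm x = 1" using speed[OF x that] .
    show "0 < k" if "x \<noteq> 0" and k: "x + r *\<^sub>R D x = k *\<^sub>R x" for k
    proof -
      have "r *\<^sub>R D x = (k - 1) *\<^sub>R x" using k by (simp add: algebra_simps)
      then have "(1 / r) *\<^sub>R (r *\<^sub>R D x) = (1 / r) *\<^sub>R ((k - 1) *\<^sub>R x)" by simp
      then have "D x = ((k - 1) / r) *\<^sub>R x" using \<open>r \<noteq> 0\<close> by simp
      then have "shape_operator S N p x = (- (k - 1) / r) *\<^sub>R x"
        by (simp only: shape_operator_def frechet_derivative_tangent[OF D x] scaleR_minus_left minus_divide_left[symmetric])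
      then have "- (k - 1) / r \<in> principal_curvatures S N p"
        unfolding principal_curvatures_def using x \<open>x \<noteq> 0\<close> by blast
      then have "\<bar>- (k - 1) / r\<bar> < 1 / \<bar>r\<bar>" using curv by blast
      then have "\<bar>k - 1\<bar> < 1" using \<open>r \<noteq> 0\<close> by (simp add: divide_less_cancel abs_minus_commute)
      then show ?thesis by simp
    qed
  qed (rule v)
  show ?thesis
  proof (intro exI ballI allI impI)
    fix v D' assume v: "v \<in> tangent_space S p" and D': "(N has_derivative D') (at p within S)"
    have "r *\<^sub>R D v = (\<sigma> - 1) *\<^sub>R v" using scalar[OF v] by (simp add: algebra_simps)
    then have "(1 / r) *\<^sub>R (r *\<^sub>R D v) = (1 / r) *\<^sub>R ((\<sigma> - 1) *\<^sub>R v)" by simp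
    then show "D' v = ((\<sigma> - 1) / r) *\<^sub>R v"
      using \<open>r \<noteq> 0\<close> frechet_derivative_tangent[OF D v] frechet_derivative_tangent[OF D' v] by simp
  qed
qed

section \<open>Rolling on a sphere\<close>

text \<open>The rotation with angular velocity \<open>\<omega>\<close> is the solution of \<open>A' = [\<omega>] A\<close>, where \<open>[\<omega>]\<close> is the matrix of \<open>x \<mapsto> \<omega> \<times> x\<close>.  The
  scalar products of the columns of a solution have zero derivative because \<open>[\<omega>]\<close> is
  skew-symmetric, and the determinant, being \<open>\<plusminus>1\<close>, stays at its initial value.\<close>

lemma rotation_path_with_angular_velocity:
  fixes \<omega> :: "real \<Rightarrow> real^3"
  assumes "0 < l" and cont: "continuous_on {0..l} \<omega>"
  obtains e A A' where "0 < e" "e \<le> l" "A 0 = mat 1" "continuous_on {0..e} A'"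
    "\<forall>t\<in>{0..e}. rotation_matrix (A t) \<and> (A has_vector_derivative A' t) (at t within {0..e})
      \<and> (\<forall>x. A' t *v x = cross3 (\<omega> t) (A t *v x))"
proof -
  \<comment> \<open>Acting on the rows of \<open>B\<close> instead of the columns of \<open>A\<close> makes the operator act componentwise; \<open>A\<close> is the transpose of \<open>B\<close>.\<close>
  define P :: "real^3 \<Rightarrow> real^3^3 \<Rightarrow> real^3^3" where "P w B = (\<chi> i. cross3 w (B $ i))" for w B
  have P: "bounded_bilinear P"
    unfolding bilinear_conv_bounded_bilinear[symmetric] bilinear_def linear_iff
    by (simp add: P_def vec_eq_iff[where 'b = 3 and 'a = "real^3"] cross_add_left cross_add_right
        cross_mult_left cross_mult_right)
  obtain e where e: "0 < e" "e \<le> l"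
    "\<And>B0. \<exists>B. B 0 = B0 \<and> (\<forall>t\<in>{0..e}. (B has_vector_derivative P (\<omega> t) (B t)) (at t within {0..e}))"
    using linear_ode_local_solution[OF P \<open>0 < l\<close> cont] by metis
  obtain B where B: "B 0 = mat 1" "\<forall>t\<in>{0..e}. (B has_vector_derivative P (\<omega> t) (B t)) (at t within {0..e})"
    using e(3) by blast
  have contB: "continuous_on {0..e} B" using B(2) by (auto intro: continuous_on_vector_derivative)
  have Bi: "((\<lambda>t. B t $ i) has_derivative (\<lambda>h. h *\<^sub>R cross3 (\<omega> t) (B t $ i))) (at t within {0..e})"
    if "t \<in> {0..e}" for t i
    using bounded_linear.has_vector_derivative[OF bounded_linear_vec_nth bspec[OF B(2) that], of i]
    by (simp add: has_vector_derivative_def P_def)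
  have orthonormal: "B t $ i \<bullet> B t $ j = mat 1 $ i $ j" if t: "t \<in> {0..e}" for t i j
  proof -
    have "((\<lambda>t. B t $ i \<bullet> B t $ j) has_derivative (\<lambda>h. 0)) (at t within {0..e})" if "t \<in> {0..e}" for t
    proof -
      have "B t $ i \<bullet> cross3 (\<omega> t) (B t $ j) + cross3 (\<omega> t) (B t $ i) \<bullet> B t $ j = 0"
        by (simp add: cross_triple[of "\<omega> t" "B t $ i"] cross_skew[of "\<omega> t" "B t $ j"] inner_commute)
          (metis cross_triple inner_commute)
      then have "(\<lambda>h. B t $ i \<bullet> (h *\<^sub>R cross3 (\<omega> t) (B t $ j)) + (h *\<^sub>R cross3 (\<omega> t) (B t $ i)) \<bullet> B t $ j) = (\<lambda>h. 0)"
        by (simp add: fun_eq_iff distrib_left[symmetric])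
      with has_derivative_inner[OF Bi[OF that, of i] Bi[OF that, of j]] show ?thesis by simp
    qed
    from has_derivative_zero_unique[OF convex_real_interval(5) this t, of 0]
    have "B t $ i \<bullet> B t $ j = (mat 1 :: real^3^3) $ i \<bullet> (mat 1 :: real^3^3) $ j"
      using e by (simp add: B(1))
    also have "\<dots> = mat 1 $ i $ j"
      using exhaust_3[of i] exhaust_3[of j] by (auto simp: mat_def inner_vec_def sum_3)
    finally show ?thesis .
  qed
  have orth: "orthogonal_matrix (B t)" if "t \<in> {0..e}" for t
  proof -
    have "B t ** transpose (B t) = mat 1"
      using orthonormal[OF that] by (simp add: vec_eq_iff matrix_matrix_mult_def transpose_def inner_vec_def)
    then show ?thesis by (simp add: orthogonal_matrix_def matrix_left_right_inverse)
  qed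
  have "continuous_on {0..e} (\<lambda>t. det (B t))"
    unfolding det_3 by (intro continuous_intros contB)
  moreover have "finite ((\<lambda>t. det (B t)) ` {0..e})"
    by (rule finite_subset[of _ "{1, -1}"]) (use det_orthogonal_matrix[OF orth] in blast, simp)
  ultimately have "(\<lambda>t. det (B t)) constant_on {0..e}" by (intro continuous_finite_range_constant) auto
  then have det: "det (B t) = 1" if "t \<in> {0..e}" for t
    using that e B(1) unfolding constant_on_def by (metis atLeastAtMost_iff det_I less_eq_real_def)
  have linT: "bounded_linear (transpose :: real^3^3 \<Rightarrow> real^3^3)"
    by (simp add: linear_conv_bounded_linear[symmetric] linear_iff transpose_def vec_eq_iff)
  show thesis
  proof (rule that[where A = "\<lambda>t. transpose (B t)" and A' = "\<lambda>t. transpose (P (\<omega> t) (B t))"])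
    show "0 < e" "e \<le> l" by fact+
    show "transpose (B 0) = mat 1" by (simp add: B(1))
    show "continuous_on {0..e} (\<lambda>t. transpose (P (\<omega> t) (B t)))"
      by (intro bounded_linear.continuous_on[OF linT] bounded_bilinear.continuous_on[OF P] contB
          continuous_on_subset[OF cont]) (use e in auto)
    show "\<forall>t\<in>{0..e}. rotation_matrix (transpose (B t))
        \<and> ((\<lambda>t. transpose (B t)) has_vector_derivative transpose (P (\<omega> t) (B t))) (at t within {0..e})
        \<and> (\<forall>x. transpose (P (\<omega> t) (B t)) *v x = cross3 (\<omega> t) (transpose (B t) *v x))"
    proof (intro ballI conjI allI)
      fix t x assume t: "t \<in> {0..e}"
      show "rotation_matrix (transpose (B t))"
        using orth[OF t] det[OF t] by (simp add: rotation_matrix_def)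
      show "((\<lambda>t. transpose (B t)) has_vector_derivative transpose (P (\<omega> t) (B t))) (at t within {0..e})"
        by (rule bounded_linear.has_vector_derivative[OF linT bspec[OF B(2) t]])
      show "transpose (P (\<omega> t) (B t)) *v x = cross3 (\<omega> t) (transpose (B t) *v x)"
        by (simp add: vec_eq_iff forall_3 matrix_vector_mult_def transpose_def P_def sum_3
            cross_components algebra_simps)
    qed
  qed
qed

lemma angular_velocity_eqI:
  assumes "\<And>x. infinitesimal_rotation l A t *v x = cross3 w x"
  shows "angular_velocity l A t = w"
  unfolding angular_velocity_def
proof (rule the_equality)
  show "\<forall>x. infinitesimal_rotation l A t *v x = cross3 w x" using assms by blast
  fix w' assume "\<forall>x. infinitesimal_rotation l A t *v x = cross3 w' x"
  then have "cross3 (w' - w) x = 0" for x using assms by (simp add: Cross3.left_diff_distrib)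
  then show "w' = w" using cross_basis_nonzero[of "w' - w"] by auto
qed

lemma normal_field_sphere:
  assumes "R > 0" and N: "unit_normal_field (sphere c R) N"
  obtains k where "\<bar>k\<bar> = 1 / R" "\<forall>q\<in>sphere c R. N q = k *\<^sub>R (q - c)"
proof -
  have q: "norm (q - c) = R" if "q \<in> sphere c R" for q
    using that by (simp add: dist_norm norm_minus_commute)
  have N1: "norm (N q) = 1" "\<And>v. (q - c) \<bullet> v = 0 \<Longrightarrow> v \<bullet> N q = 0" if "q \<in> sphere c R" for q
    using N that tangent_space_sphere[OF \<open>R > 0\<close> q[OF that]]
    by (auto simp: unit_normal_field_def inner_commute)
  define h where "h q = (q - c) \<bullet> N q / R\<^sup>2" for q
  have h: "N q = h q *\<^sub>R (q - c) \<and> \<bar>h q\<bar> = 1 / R" if "q \<in> sphere c R" for q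
  proof -
    have "N q = (((1 / R) *\<^sub>R (q - c)) \<bullet> N q) *\<^sub>R ((1 / R) *\<^sub>R (q - c))"
      by (rule parallel_if_same_hyperplane) (use N1[OF that] q[OF that] \<open>R > 0\<close> in auto)
    then have *: "N q = h q *\<^sub>R (q - c)" by (simp add: h_def power2_eq_square)
    then have "1 = \<bar>h q\<bar> * R" using N1(1)[OF that] q[OF that] by (metis norm_scaleR)
    then show ?thesis using * \<open>R > 0\<close> by (simp add: field_simps)
  qed
  have "continuous_on (sphere c R) h"
    unfolding h_def using N \<open>R > 0\<close> by (intro continuous_intros) (auto simp: unit_normal_field_def)
  \<comment> \<open>Orthogonality to the sphere leaves a choice of sign at each point; connectedness makes it uniform.\<close>
  moreover have "finite (h ` sphere c R)"
  proof (rule finite_subset[of _ "{1 / R, - (1 / R)}"])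
    show "h ` sphere c R \<subseteq> {1 / R, - (1 / R)}" using h by (force simp: abs_if split: if_splits)
  qed simp
  moreover have "connected (sphere c R)" by (rule connected_sphere) simp
  ultimately have "h constant_on sphere c R" by (intro continuous_finite_range_constant)
  then obtain k where k: "\<And>q. q \<in> sphere c R \<Longrightarrow> h q = k" unfolding constant_on_def by blast
  obtain q where "q \<in> sphere c R"
    using \<open>R > 0\<close> sphere_eq_empty[of c R] by (metis ex_in_conv less_asym)
  then have "\<bar>k\<bar> = 1 / R" using h k by metis
  moreover have "\<forall>q\<in>sphere c R. N q = k *\<^sub>R (q - c)" using h k by metis
  ultimately show thesis by (rule that)
qed

text \<open>The center runs on \<open>\<zeta> = c + m (\<gamma> - c)\<close> with \<open>m = 1 + r k\<close>, so its velocity is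
  \<open>m \<gamma>'\<close>, of length \<open>m\<close>.  The contact point must be at rest, which forces
  \<open>m \<gamma>' = \<omega> \<times> r N\<close>; the solution tangent to the sphere is \<open>\<omega> = (m / r) N \<times> \<gamma>'\<close>.
  It does not vanish because \<open>m > 0\<close>.  Integrating \<open>\<omega>\<close> to a path of rotations \<open>A\<close>
  and choosing the translation so that the center follows \<open>\<zeta>\<close> gives the rolling.\<close>

lemma ball_rolls_on_sphere:
  assumes "R > 0" and S: "unit_normal_field (sphere c R) N" and "r \<noteq> 0"
    and k: "\<forall>q\<in>sphere c R. N q = k *\<^sub>R (q - c)" and m: "1 + r * k > 0"
    and \<gamma>: "unit_speed_curve (sphere c R) l \<gamma>"
  shows "\<exists>e A b. 0 < e \<and> e \<le> l \<and> ball_rolls (sphere c R) N r e \<gamma> A b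
    \<and> ball_speed e A b (ball_center N r (\<gamma> 0)) 0 = 1 + r * k"
proof -
  define m where "m = 1 + r * k"
  have m0: "m > 0" using m by (simp add: m_def)
  obtain \<gamma>' where g: "0 < l" "\<gamma> ` {0..l} \<subseteq> sphere c R" "continuous_on {0..l} \<gamma>" "continuous_on {0..l} \<gamma>'"
    "\<forall>t\<in>{0..l}. (\<gamma> has_vector_derivative \<gamma>' t) (at t within {0..l}) \<and> norm (\<gamma>' t) = 1"
    using unit_speed_curveD[OF \<gamma>] .
  have on: "\<gamma> t \<in> sphere c R" if "t \<in> {0..l}" for t using g(2) that by blast
  have dist: "norm (\<gamma> t - c) = R" if "t \<in> {0..l}" for t
    using on[OF that] by (simp add: dist_norm norm_minus_commute)
  have perp: "(\<gamma> t - c) \<bullet> \<gamma>' t = 0" if t: "t \<in> {0..l}" for t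
  proof -
    have "(\<gamma> has_derivative (\<lambda>h. h *\<^sub>R \<gamma>' t)) (at t within {0..l})"
      using g(5) t by (simp add: has_vector_derivative_def)
    then have d: "((\<lambda>t. (\<gamma> t - c) \<bullet> (\<gamma> t - c)) has_derivative
        (\<lambda>h. (\<gamma> t - c) \<bullet> (h *\<^sub>R \<gamma>' t) + (h *\<^sub>R \<gamma>' t) \<bullet> (\<gamma> t - c))) (at t within {0..l})"
      by (auto intro!: derivative_eq_intros)
    have d2: "((\<lambda>t. (\<gamma> t - c) \<bullet> (\<gamma> t - c)) has_vector_derivative 2 * ((\<gamma> t - c) \<bullet> \<gamma>' t)) (at t within {0..l})"
      unfolding has_vector_derivative_def
      by (rule has_derivative_eq_rhs[OF d]) (simp add: fun_eq_iff inner_commute)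
    have d0: "((\<lambda>t. (\<gamma> t - c) \<bullet> (\<gamma> t - c)) has_vector_derivative 0) (at t within {0..l})"
      by (rule has_vector_derivative_transform[OF t _ has_vector_derivative_const[of "R\<^sup>2"]])
        (use dist in \<open>simp add: power2_norm_eq_inner[symmetric]\<close>)
    show ?thesis
      using vector_derivative_within_closed_interval[OF g(1) t d2]
        vector_derivative_within_closed_interval[OF g(1) t d0] by simp
  qed
  \<comment> \<open>This is \<open>(m / r) N \<times> \<gamma>'\<close>, written with \<open>N = k (\<gamma> - c)\<close>.\<close>
  define \<omega> where "\<omega> t = (m * k / r) *\<^sub>R cross3 (\<gamma> t - c) (\<gamma>' t)" for t
  have cont\<omega>: "continuous_on {0..l} \<omega>"
    unfolding \<omega>_def by (intro continuous_intros continuous_on_cross g)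
  obtain e A A' where e: "0 < e" "e \<le> l" and A0: "A 0 = mat 1" and contA': "continuous_on {0..e} A'"
    and A: "\<forall>t\<in>{0..e}. rotation_matrix (A t) \<and> (A has_vector_derivative A' t) (at t within {0..e})
      \<and> (\<forall>x. A' t *v x = cross3 (\<omega> t) (A t *v x))"
    using rotation_path_with_angular_velocity[OF g(1) cont\<omega>] .
  have el: "t \<in> {0..l}" if "t \<in> {0..e}" for t using that e by auto
  define \<zeta> where "\<zeta> t = c + m *\<^sub>R (\<gamma> t - c)" for t
  have center: "ball_center N r (\<gamma> t) = \<zeta> t" if "t \<in> {0..l}" for t
    unfolding ball_center_def bspec[OF k on[OF that]] \<zeta>_def m_def by (simp add: algebra_simps)
  define b where "b t = \<zeta> t - A t *v \<zeta> 0" for t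
  define b' where "b' t = m *\<^sub>R \<gamma>' t - A' t *v \<zeta> 0" for t
  have \<gamma>d: "(\<gamma> has_vector_derivative \<gamma>' t) (at t within {0..e})" if "t \<in> {0..e}" for t
    by (rule has_vector_derivative_within_subset[of _ _ _ "{0..l}"]) (use g(5) that e in auto)
  have \<zeta>d: "(\<zeta> has_vector_derivative m *\<^sub>R \<gamma>' t) (at t within {0..e})" if "t \<in> {0..e}" for t
  proof -
    have "((\<lambda>t. c + m *\<^sub>R (\<gamma> t - c)) has_vector_derivative 0 + m *\<^sub>R (\<gamma>' t - 0)) (at t within {0..e})"
      by (intro has_vector_derivative_add has_vector_derivative_diff has_vector_derivative_const
          bounded_linear.has_vector_derivative[OF bounded_linear_scaleR_right] \<gamma>d that)
    then show ?thesis by (simp add: \<zeta>_def[abs_def])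
  qed
  have Ad: "(A has_vector_derivative A' t) (at t within {0..e})" if "t \<in> {0..e}" for t
    using A that by blast
  have Axd: "((\<lambda>t. A t *v x) has_vector_derivative A' t *v x) (at t within {0..e})" if "t \<in> {0..e}" for t x
    by (rule bounded_linear.has_vector_derivative[OF bounded_linear_matrix_vector_mult_left Ad[OF that]])
  have bd: "(b has_vector_derivative b' t) (at t within {0..e})" if "t \<in> {0..e}" for t
    unfolding b_def b'_def by (intro has_vector_derivative_diff \<zeta>d Axd that)
  have A'x: "A' t *v x = cross3 (\<omega> t) (A t *v x)" if "t \<in> {0..e}" for t x using A that by blast
  have rot: "rotation_matrix (A t)" if "t \<in> {0..e}" for t using A that by blast
  have orth: "A t ** transpose (A t) = mat 1" if "t \<in> {0..e}" for t
    using rot[OF that] by (simp add: rotation_matrix_def orthogonal_matrix_def)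
  have motion_center: "affine_motion A b t (\<zeta> 0) = \<zeta> t" for t
    by (simp add: affine_motion_def b_def)
  have "k \<noteq> 0"
  proof
    assume "k = 0"
    then have "N (\<gamma> 0) = 0" using k on[of 0] g(1) by simp
    moreover have "norm (N (\<gamma> 0)) = 1" using S on[of 0] g(1) by (simp add: unit_normal_field_def)
    ultimately show False by simp
  qed
  have kR: "k\<^sup>2 * R\<^sup>2 = 1"
  proof -
    have "\<bar>k\<bar> * R = norm (N (\<gamma> 0))" using k on[of 0] dist[of 0] g(1) by simp
    also have "\<dots> = 1" using S on[of 0] g(1) by (simp add: unit_normal_field_def)
    finally show ?thesis by (metis power2_abs power_mult_distrib power_one)
  qed
  have \<omega>0: "\<omega> t \<noteq> 0" if "t \<in> {0..l}" for t
  proof -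
    have "(norm (cross3 (\<gamma> t - c) (\<gamma>' t)))\<^sup>2 = R\<^sup>2"
      using norm_cross[of "\<gamma> t - c" "\<gamma>' t"] perp[OF that] dist[OF that] g(5) that by simp
    then have "cross3 (\<gamma> t - c) (\<gamma>' t) \<noteq> 0" using \<open>R > 0\<close> by auto
    then show ?thesis using m0 \<open>k \<noteq> 0\<close> \<open>r \<noteq> 0\<close> by (simp add: \<omega>_def)
  qed
  have inf: "infinitesimal_rotation e A t *v x = cross3 (\<omega> t) x" if "t \<in> {0..e}" for t x
  proof -
    have A'_eq: "vector_derivative A (at t within {0..e}) = A' t"
      by (rule vector_derivative_within_closed_interval[OF e(1) that Ad[OF that]])
    have "infinitesimal_rotation e A t *v x = A' t *v (transpose (A t) *v x)"
      unfolding infinitesimal_rotation_def A'_eq by (rule matrix_vector_mul_assoc[symmetric])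
    also have "\<dots> = cross3 (\<omega> t) x"
    proof -
      have "A t *v (transpose (A t) *v x) = x"
        unfolding matrix_vector_mul_assoc orth[OF that] by simp
      then show ?thesis by (simp only: A'x[OF that])
    qed
    finally show ?thesis .
  qed
  have inst: "instantaneous_motion e A b t (\<gamma> t) = 0" if t: "t \<in> {0..e}" for t
  proof -
    \<comment> \<open>The point of the ball, in its initial position, that is in contact at time \<open>t\<close>.\<close>
    define x0 where "x0 = inv (affine_motion A b t) (\<gamma> t)"
    have "affine_motion A b t (transpose (A t) *v (\<gamma> t - b t)) = \<gamma> t"
      unfolding affine_motion_def matrix_vector_mul_assoc orth[OF t] by simp
    then have "\<gamma> t \<in> range (affine_motion A b t)" by (metis rangeI)
    then have x0: "A t *v x0 + b t = \<gamma> t"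
      unfolding x0_def using f_inv_into_f[of "\<gamma> t" "affine_motion A b t" UNIV] by (simp add: affine_motion_def)
    have "((\<lambda>s. affine_motion A b s x0) has_vector_derivative A' t *v x0 + b' t) (at t within {0..e})"
      unfolding affine_motion_def by (intro has_vector_derivative_add Axd bd t)
    then have "instantaneous_motion e A b t (\<gamma> t) = A' t *v x0 + b' t"
      unfolding instantaneous_motion_def x0_def[symmetric]
      by (rule vector_derivative_within_closed_interval[OF e(1) t])
    also have "\<dots> = cross3 (\<omega> t) (A t *v x0 - A t *v \<zeta> 0) + m *\<^sub>R \<gamma>' t"
      by (simp add: b'_def A'x[OF t] Cross3.right_diff_distrib)
    also have "A t *v x0 - A t *v \<zeta> 0 = \<gamma> t - \<zeta> t" using x0 by (simp add: b_def algebra_simps)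
    also have "\<gamma> t - \<zeta> t = - (r * k) *\<^sub>R (\<gamma> t - c)" by (simp add: \<zeta>_def m_def algebra_simps)
    also have "cross3 (\<omega> t) (- (r * k) *\<^sub>R (\<gamma> t - c)) = (m * k\<^sup>2) *\<^sub>R cross3 (\<gamma> t - c) (cross3 (\<gamma> t - c) (\<gamma>' t))"
      using \<open>r \<noteq> 0\<close> cross_skew[of "cross3 (\<gamma> t - c) (\<gamma>' t)"]
      by (simp add: \<omega>_def cross_mult_left cross_mult_right power2_eq_square)
    also have "cross3 (\<gamma> t - c) (cross3 (\<gamma> t - c) (\<gamma>' t)) = - (R\<^sup>2) *\<^sub>R \<gamma>' t"
      using perp[OF el[OF t]] dist[OF el[OF t]] by (simp add: Lagrange power2_norm_eq_inner[symmetric])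
    finally show ?thesis using kR by (simp add: mult.assoc)
  qed
  have "rolling (sphere (\<zeta> 0) \<bar>r\<bar>) (sphere c R) e \<gamma> A b"
    unfolding rolling_def rotational_motion_def
  proof (intro conjI ballI)
    fix t assume t: "t \<in> {0..e}"
    obtain x where "cross3 (\<omega> t) x \<noteq> 0" using cross_basis_nonzero[OF \<omega>0[OF el[OF t]]] by blast
    then show "infinitesimal_rotation e A t \<noteq> 0" using inf[OF t] by auto
    show "instantaneous_motion e A b t (\<gamma> t) = 0" by (rule inst[OF t])
    have "angular_velocity e A t = \<omega> t" by (rule angular_velocity_eqI[OF inf[OF t]])
    then show "angular_velocity e A t \<in> tangent_space (sphere c R) (\<gamma> t)"
      using tangent_space_sphere[OF \<open>R > 0\<close> dist[OF el[OF t]]] by (simp add: \<omega>_def dot_cross_self)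
  next
    show "motion_along (sphere (\<zeta> 0) \<bar>r\<bar>) (sphere c R) e \<gamma> A b"
      unfolding motion_along_def
    proof (intro conjI ballI)
      show "C1_upto e A" unfolding C1_upto_def using Ad contA' by blast
      have "continuous_on {0..e} b'"
        unfolding b'_def
        by (intro continuous_intros bounded_linear.continuous_on[OF bounded_linear_matrix_vector_mult_left]
            contA' continuous_on_subset[OF g(4)]) (use e in auto)
      then show "C1_upto e b" unfolding C1_upto_def using bd by blast
      show "affine_motion A b 0 = id" by (simp add: fun_eq_iff affine_motion_def b_def A0)
      fix t assume t: "t \<in> {0..e}"
      show "rotation_matrix (A t)" by (rule rot[OF t])
      have gz: "\<gamma> t - \<zeta> t = - (r * k) *\<^sub>R (\<gamma> t - c)" by (simp add: \<zeta>_def m_def algebra_simps)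
      have "\<bar>k\<bar> * R = 1" using kR \<open>R > 0\<close>
        by (metis abs_mult abs_of_pos abs_one abs_square_eq_1 power_mult_distrib)
      then have r: "norm (\<gamma> t - \<zeta> t) = \<bar>r\<bar>"
        unfolding gz using dist[OF el[OF t]] by (simp add: abs_mult mult.assoc)
      have "tangent_space (sphere (\<zeta> t) \<bar>r\<bar>) (\<gamma> t) = tangent_space (sphere c R) (\<gamma> t)"
        using tangent_space_sphere[OF _ r] tangent_space_sphere[OF \<open>R > 0\<close> dist[OF el[OF t]]] \<open>r \<noteq> 0\<close> \<open>k \<noteq> 0\<close>
        by (simp add: gz)
      then show "tangent_at (affine_motion A b t ` sphere (\<zeta> 0) \<bar>r\<bar>) (sphere c R) (\<gamma> t)"
        unfolding affine_motion_sphere[where A = A and t = t, OF rot[OF t]] motion_center tangent_at_def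
        using r on[OF el[OF t]] by (simp add: dist_norm norm_minus_commute)
    qed
  qed
  then have "ball_rolls (sphere c R) N r e \<gamma> A b"
    using center[of 0] g(1) by (simp add: ball_rolls_def)
  moreover have "ball_speed e A b (ball_center N r (\<gamma> 0)) 0 = m"
    using vector_derivative_within_closed_interval[OF e(1) _ \<zeta>d[of 0]] e g(5) m0 center[of 0]
    by (simp add: ball_speed_def motion_center)
  ultimately show ?thesis using e by (auto simp: m_def)
qed

section \<open>The characterization of spheres\<close>

theorem corollary1p5:
  fixes S :: "(real^3) set" and N :: "real^3 \<Rightarrow> real^3" and r :: real
  assumes "C2_surface S" and "S \<noteq> {}" and "compact S" and "connected S"
    and "unit_normal_field S N"
    and "r \<noteq> 0"
    and "\<forall>p\<in>S. \<forall>k\<in>principal_curvatures S N p. \<bar>k\<bar> < 1 / \<bar>r\<bar>"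
  shows "(\<exists>c R. R > 0 \<and> S = sphere c R) \<longleftrightarrow> (\<forall>p\<in>S. rolls_isotropically S N r p)"
proof
  assume "\<exists>c R. R > 0 \<and> S = sphere c R"
  then obtain c R where "R > 0" and S: "S = sphere c R" by blast
  obtain k where k: "\<bar>k\<bar> = 1 / R" "\<forall>q\<in>S. N q = k *\<^sub>R (q - c)"
    using normal_field_sphere[OF \<open>R > 0\<close>] assms(5) unfolding S .
  have small: "\<bar>k\<bar> < 1 / \<bar>r\<bar>" if p: "p \<in> S" for p
  proof -
    have D: "(N has_derivative (\<lambda>v. k *\<^sub>R v)) (at p within S)"
    proof (rule has_derivative_transform[OF p])
      show "((\<lambda>q. k *\<^sub>R (q - c)) has_derivative (\<lambda>v. k *\<^sub>R v)) (at p within S)"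
        by (auto intro!: derivative_eq_intros)
    qed (use k in auto)
    have T: "tangent_space S p = {v. N p \<bullet> v = 0}"
      by (rule tangent_space_eq_normal_complement[OF assms(1,5) p])
    obtain v where v: "v \<noteq> 0" "orthogonal (N p) v" using orthogonal_to_vector_exists[of "N p"] by auto
    then have vT: "v \<in> tangent_space S p" by (simp add: T orthogonal_def)
    have "shape_operator S N p v = (- k) *\<^sub>R v"
      by (simp add: shape_operator_def frechet_derivative_tangent[OF D vT])
    then have "- k \<in> principal_curvatures S N p" unfolding principal_curvatures_def using v vT by blast
    then show ?thesis using assms(7) p by force
  qed
  show "\<forall>p\<in>S. rolls_isotropically S N r p"
  proof
    fix p assume p: "p \<in> S"
    have "\<bar>r * k\<bar> < 1" using small[OF p] \<open>r \<noteq> 0\<close> by (simp add: abs_mult field_simps)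
    then have m: "1 + r * k > 0" by linarith
    show "rolls_isotropically S N r p"
      unfolding rolls_isotropically_def
    proof (rule exI[of _ "1 + r * k"], intro ballI impI allI, elim conjE)
      fix v :: "real^3" and l \<gamma> assume "unit_speed_curve S l \<gamma>" "\<gamma> 0 = p"
      then show "\<exists>e A b. 0 < e \<and> e \<le> l \<and> ball_rolls S N r e \<gamma> A b \<and>
          ball_speed e A b (ball_center N r p) 0 = 1 + r * k"
        using ball_rolls_on_sphere[OF \<open>R > 0\<close> _ \<open>r \<noteq> 0\<close> _ m, of c N l \<gamma>] assms(5) k(2) unfolding S by blast
    qed
  qed
next
  assume iso: "\<forall>p\<in>S. rolls_isotropically S N r p"
  have "\<forall>p\<in>S. \<exists>\<mu>. \<forall>v\<in>tangent_space S p. \<forall>D. (N has_derivative D) (at p within S) \<longrightarrow> D v = \<mu> *\<^sub>R v"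
    using isotropic_imp_umbilic[OF assms(1,5) _ \<open>r \<noteq> 0\<close>] assms(7) iso by blast
  then obtain \<mu> where \<mu>: "\<forall>p\<in>S. \<forall>v\<in>tangent_space S p. \<forall>D. (N has_derivative D) (at p within S) \<longrightarrow> D v = \<mu> p *\<^sub>R v"
    by metis
  show "\<exists>c R. R > 0 \<and> S = sphere c R"
    by (rule compact_umbilic_surface_is_sphere[OF assms(1,5,2,3,4), of \<mu>]) (use \<mu> in blast)
qed

end
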